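(* Let $T_0>0$, $\Theta\subseteq\mathbb{R}^K$ open, and $\theta\mapsto h_\theta\in L_2[0,T_0]$ a mapping satisfying: (P6) $h_\theta$ is Fréchet differentiable in $\theta$, i.e. for each $\theta$ there is a continuous linear operator $\frac{\partial h_\theta}{\partial\theta}:\mathbb{R}^K\to L_2[0,T_0]$ with $h_{\theta+\delta}-h_\theta=\frac{\partial h_\theta}{\partial\theta}\delta+o(\|\delta\|)$; and (P7) the null space of $\frac{\partial h_\theta}{\partial\theta}$ is $\{0\}$ for every $\theta$. Let $x=h_\theta$ for an unknown deterministic $\theta\in\Theta$, and suppose one observes $y(t)=x(t)+w(t)$, $t\in[0,T_0]$, where $w$ is continuous-time white Gaussian noise of level $\sigma_c^2$ (equivalently, one observes $z(t)=\int_0^t x(\tau)\,d\tau+\sigma_c b(t)$, $t\in[0,T_0]$, with $b$ a standard Wiener process). Then every estimator $\hat{x}$ of $x$ from these measurements that is unbiased (i.e. $\mathbb{E}_\theta[\hat x]=h_\theta$ for all $\theta\in\Theta$) and has finite second moment $\mathbb{E}_\theta\|\hat x\|_{L_2}^2<\infty$ satisfies $$\mathbb{E}_\theta\int_0^{T_0}|\hat{x}(t)-x(t)|^2\,dt\;\ge\;K\sigma_c^2.$$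
   Context: $L_2[0,T_0]$ is the Hilbert space of square-integrable complex functions on $[0,T_0]$ with $\langle f,g\rangle=\int_0^{T_0}f(t)g^*(t)\,dt$. White noise $w$ means that for $f,g\in L_2$, $\langle f,w\rangle,\langle g,w\rangle$ are zero-mean jointly Gaussian with $\mathbb{E}[\langle f,w\rangle\langle g,w\rangle^*]=\sigma_c^2\langle f,g\rangle$. Expectation of an $L_2$-valued random variable is understood weakly: $\mathbb{E}[v]$ is the $k$ with $\langle k,\varphi\rangle=\mathbb{E}\langle v,\varphi\rangle$ for all $\varphi$.
   Formalization: Signals, estimators and noise are real-valued (real L_2[0,T_0]) rather than complex: for complex signals the bound fails, e.g. h_θ=iθg with real Wiener noise is observed noise-free, and circular complex noise gives only Kσ_c²/2. *)

theory Defs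
  imports "HOL-Probability.Probability"
begin

text \<open>Real L2[0,T0]: (Borel) measurable functions on the reals that are square integrable
  on [0,T0]; only their restriction to [0,T0] matters.\<close>
definition L2 :: "real \<Rightarrow> (real \<Rightarrow> real) set" where
  "L2 T0 = {f. f \<in> borel_measurable lborel \<and> set_integrable lborel {0..T0} (\<lambda>t. (f t)^2)}"

definition L2inner :: "real \<Rightarrow> (real \<Rightarrow> real) \<Rightarrow> (real \<Rightarrow> real) \<Rightarrow> real" where
  "L2inner T0 f g = (LINT t:{0..T0}|lborel. f t * g t)"

definition L2norm :: "real \<Rightarrow> (real \<Rightarrow> real) \<Rightarrow> real" where
  "L2norm T0 f = sqrt (LINT t:{0..T0}|lborel. (f t)^2)"

definition gaussian_rv :: "'w measure \<Rightarrow> ('w \<Rightarrow> real) \<Rightarrow> real \<Rightarrow> real \<Rightarrow> bool" where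
  "gaussian_rv M X mu v \<longleftrightarrow> X \<in> borel_measurable M \<and>
     ((v = 0 \<and> (AE w in M. X w = mu)) \<or>
      (v > 0 \<and> distributed M lborel X (normal_density mu (sqrt v))))"

text \<open>White noise of level sigma^2 on L2[0,T0]: W w f plays the role of the pairing of f
  with the noise.  For f, g in L2 the pair (W f, W g) is zero-mean jointly Gaussian
  with covariance sigma^2 <f,g>; jointly Gaussian is expressed (Cramer-Wold) by: every
  linear combination a W f + b W g is Gaussian, with mean 0 and variance
  sigma^2 (a^2 |f|^2 + 2ab <f,g> + b^2 |g|^2).\<close>
definition white_noise :: "'w measure \<Rightarrow> real \<Rightarrow> real \<Rightarrow> ('w \<Rightarrow> (real \<Rightarrow> real) \<Rightarrow> real) \<Rightarrow> bool" where
  "white_noise M T0 \<sigma> W \<longleftrightarrow>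
     (\<forall>f\<in>L2 T0. \<forall>g\<in>L2 T0. \<forall>a b::real.
        gaussian_rv M (\<lambda>w. a * W w f + b * W w g) 0
          (\<sigma>^2 * (a^2 * L2inner T0 f f + 2 * a * b * L2inner T0 f g + b^2 * L2inner T0 g g)))"

text \<open>Measurement space: the observation y = x + w is seen through all its pairings
  with test functions phi in L2 (product sigma-algebra).\<close>
definition obs_space :: "real \<Rightarrow> ((real \<Rightarrow> real) \<Rightarrow> real) measure" where
  "obs_space T0 = PiM (L2 T0) (\<lambda>_. borel)"

definition observation ::
  "real \<Rightarrow> (real \<Rightarrow> real) \<Rightarrow> ('w \<Rightarrow> (real \<Rightarrow> real) \<Rightarrow> real) \<Rightarrow> 'w \<Rightarrow> (real \<Rightarrow> real) \<Rightarrow> real" where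
  "observation T0 x W w = restrict (\<lambda>\<phi>. L2inner T0 \<phi> x + W w \<phi>) (L2 T0)"

end

theory Submission
  imports Defs
begin

text \<open>
  By the Cameron--Martin theorem, the law of the observation of a signal \<open>x'\<close> has density
  \<open>L = exp (W d / \<sigma>\<^sup>2 - |d|\<^sup>2 / (2 \<sigma>\<^sup>2))\<close>, \<open>d = x' - x\<close>, with respect to the law of the observation of \<open>x\<close>,
  and \<open>E (L - 1)\<^sup>2 = exp (|d|\<^sup>2 / \<sigma>\<^sup>2) - 1\<close>. Writing \<open>\<langle>h \<theta>' - h \<theta>, e\<rangle>\<close> as the expectation of
  \<open>\<langle>xhat - x, e\<rangle> (L - 1)\<close> and using the Cauchy--Schwarz inequality gives the
  Hammersley--Chapman--Robbins bound
  \<open>\<langle>h \<theta>' - h \<theta>, e\<rangle>\<^sup>2 \<le> E \<langle>xhat - x, e\<rangle>\<^sup>2 (exp (|h \<theta>' - h \<theta>|\<^sup>2 / \<sigma>\<^sup>2) - 1)\<close>.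
  If \<open>e\<close> is a unit vector in the range of the derivative, letting \<open>\<theta>'\<close> tend to \<open>\<theta>\<close> in the direction
  that the derivative maps to \<open>e\<close> yields \<open>E \<langle>xhat - x, e\<rangle>\<^sup>2 \<ge> \<sigma>\<^sup>2\<close>. The derivative is injective, so its
  range has an orthonormal basis of \<open>K\<close> vectors, and Bessel's inequality sums up these bounds.
\<close>

section \<open>Square integrable functions\<close>

lemma L2_measurable: "f \<in> L2 T \<Longrightarrow> f \<in> borel_measurable lborel"
  by (simp add: L2_def)

lemma abs_mult_le_sum_squares: "\<bar>a * b\<bar> \<le> a\<^sup>2 + b\<^sup>2" for a b :: real
proof -
  have "2 * (\<bar>a\<bar> * \<bar>b\<bar>) \<le> a\<^sup>2 + b\<^sup>2"
    using sum_squares_bound[of "\<bar>a\<bar>" "\<bar>b\<bar>"] by simp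
  moreover have "0 \<le> \<bar>a\<bar> * \<bar>b\<bar>" by simp
  ultimately show ?thesis unfolding abs_mult by linarith
qed

lemma set_integrable_L2_mult:
  assumes "f \<in> L2 T" "g \<in> L2 T"
  shows "set_integrable lborel {0..T} (\<lambda>t. f t * g t)"
proof (rule set_integrable_bound)
  show "set_integrable lborel {0..T} (\<lambda>t. (f t)\<^sup>2 + (g t)\<^sup>2)"
    using assms by (intro set_integral_add) (auto simp: L2_def)
  show "set_borel_measurable lborel {0..T} (\<lambda>t. f t * g t)"
    using assms[THEN L2_measurable] by (simp add: set_borel_measurable_def)
  show "AE x in lborel. x \<in> {0..T} \<longrightarrow> norm (f x * g x) \<le> norm ((f x)\<^sup>2 + (g x)\<^sup>2)"
    using abs_mult_le_sum_squares by simp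
qed

lemma L2_lincomb:
  assumes "f \<in> L2 T" "g \<in> L2 T"
  shows "(\<lambda>t. a * f t + b * g t) \<in> L2 T"
proof -
  have "set_integrable lborel {0..T} (\<lambda>t. a\<^sup>2 * (f t * f t) + (2*a*b * (f t * g t) + b\<^sup>2 * (g t * g t)))"
    using assms by (intro set_integral_add set_integrable_mult_right set_integrable_L2_mult)
  then have "set_integrable lborel {0..T} (\<lambda>t. (a * f t + b * g t)\<^sup>2)"
    by (simp add: power2_eq_square algebra_simps)
  then show ?thesis
    using assms by (auto simp: L2_def)
qed

lemma L2_zero: "(\<lambda>t. 0) \<in> L2 T"
  by (simp add: L2_def set_integrable_def)

lemma L2_diff: "f \<in> L2 T \<Longrightarrow> g \<in> L2 T \<Longrightarrow> (\<lambda>t. f t - g t) \<in> L2 T"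
  using L2_lincomb[of f T g 1 "-1"] by simp

lemma L2_sum:
  assumes "finite S" "\<And>i. i \<in> S \<Longrightarrow> f i \<in> L2 T"
  shows "(\<lambda>t. \<Sum>i\<in>S. c i * f i t) \<in> L2 T"
  using assms
proof (induction S rule: finite_induct)
  case (insert i S)
  then show ?case
    using L2_lincomb[of "f i" T "\<lambda>t. \<Sum>i\<in>S. c i * f i t" "c i" 1] by simp
qed (simp add: L2_zero)

lemma L2inner_commute: "L2inner T f g = L2inner T g f"
  by (simp add: L2inner_def mult.commute)

lemma L2inner_lincomb_left:
  assumes "f \<in> L2 T" "g \<in> L2 T" "u \<in> L2 T"
  shows "L2inner T (\<lambda>t. a * f t + b * g t) u = a * L2inner T f u + b * L2inner T g u"
proof -
  have "L2inner T (\<lambda>t. a * f t + b * g t) u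
      = (LINT t:{0..T}|lborel. a * (f t * u t) + b * (g t * u t))"
    by (simp add: L2inner_def algebra_simps)
  also have "\<dots> = a * L2inner T f u + b * L2inner T g u"
    using assms set_integrable_L2_mult[of f T u] set_integrable_L2_mult[of g T u]
    by (subst set_integral_add(2)) (auto simp: L2inner_def)
  finally show ?thesis .
qed

lemma L2inner_lincomb_right:
  assumes "f \<in> L2 T" "g \<in> L2 T" "u \<in> L2 T"
  shows "L2inner T u (\<lambda>t. a * f t + b * g t) = a * L2inner T u f + b * L2inner T u g"
  using L2inner_lincomb_left[OF assms] by (simp add: L2inner_commute)

lemma L2inner_diff_left:
  "f \<in> L2 T \<Longrightarrow> g \<in> L2 T \<Longrightarrow> u \<in> L2 T \<Longrightarrow>
    L2inner T (\<lambda>t. f t - g t) u = L2inner T f u - L2inner T g u"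
  using L2inner_lincomb_left[of f T g u 1 "-1"] by simp

lemma L2inner_diff_right:
  "f \<in> L2 T \<Longrightarrow> g \<in> L2 T \<Longrightarrow> u \<in> L2 T \<Longrightarrow>
    L2inner T u (\<lambda>t. f t - g t) = L2inner T u f - L2inner T u g"
  using L2inner_lincomb_right[of f T g u 1 "-1"] by simp

lemma L2inner_zero_left: "L2inner T (\<lambda>t. 0) u = 0"
  by (simp add: L2inner_def)

lemma L2inner_scale_left: "L2inner T (\<lambda>t. c * f t) u = c * L2inner T f u"
  by (simp add: L2inner_def mult.assoc)

lemma L2inner_scale_right: "L2inner T u (\<lambda>t. c * f t) = c * L2inner T u f"
  by (simp add: L2inner_def mult.left_commute)

lemma L2inner_sum_left:
  assumes "finite S" "\<And>i. i \<in> S \<Longrightarrow> f i \<in> L2 T" "u \<in> L2 T"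
  shows "L2inner T (\<lambda>t. \<Sum>i\<in>S. c i * f i t) u = (\<Sum>i\<in>S. c i * L2inner T (f i) u)"
  using assms
proof (induction S rule: finite_induct)
  case (insert i S)
  then show ?case
    using L2inner_lincomb_left[of "f i" T "\<lambda>t. \<Sum>i\<in>S. c i * f i t" u "c i" 1]
      L2_sum[of S f T c] by simp
qed (simp add: L2inner_zero_left)

lemma L2inner_self_nonneg: "L2inner T f f \<ge> 0"
  by (auto simp: L2inner_def set_lebesgue_integral_def intro!: Bochner_Integration.integral_nonneg)

lemma L2norm_square: "(L2norm T f)\<^sup>2 = L2inner T f f"
  using L2inner_self_nonneg[of T f] by (simp add: L2norm_def L2inner_def power2_eq_square)

lemma L2norm_nonneg: "L2norm T f \<ge> 0"
  using L2inner_self_nonneg[of T f] by (simp add: L2norm_def L2inner_def power2_eq_square)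

lemma L2norm_eq_0_iff: "L2norm T f = 0 \<longleftrightarrow> L2inner T f f = 0"
  using L2norm_square[of T f] by auto

section \<open>Cauchy--Schwarz and Bessel inequalities\<close>

lemma quadratic_nonneg_imp_discriminant:
  fixes a b c :: real
  assumes "c \<ge> 0" and nonneg: "\<And>x. 0 \<le> a + 2 * x * b + x\<^sup>2 * c"
  shows "b\<^sup>2 \<le> a * c"
proof (cases "c = 0")
  case True
  have "b = 0"
  proof (rule ccontr)
    assume "b \<noteq> 0"
    \<comment> \<open>For \<open>c = 0\<close> the quadratic is affine, and this argument gives it
      the value -1.\<close>
    then show False
      using nonneg[of "- (a + 1) / (2 * b)"] True by (simp add: field_simps)
  qed
  then show ?thesis
    using True by simp
next
  case False
  with \<open>c \<ge> 0\<close> have "c > 0" by simp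
  have "0 \<le> (a + 2 * (- b / c) * b + (- b / c)\<^sup>2 * c) * c"
    using nonneg[of "- b / c"] \<open>c > 0\<close> by (intro mult_nonneg_nonneg) auto
  also have "\<dots> = a * c - b\<^sup>2"
    using False by (simp add: field_simps power2_eq_square)
  finally show ?thesis by simp
qed

text \<open>Elements of \<open>L2 T\<close> are functions rather than classes, so the form is only
  semidefinite. The discriminant of the nonnegative polynomial
  \<open>x \<mapsto> |f + x g|\<^sup>2\<close> covers null vectors \<open>g\<close> as well.\<close>

lemma L2inner_Cauchy_Schwarz:
  assumes "f \<in> L2 T" "g \<in> L2 T"
  shows "(L2inner T f g)\<^sup>2 \<le> L2inner T f f * L2inner T g g"
proof (rule quadratic_nonneg_imp_discriminant[OF L2inner_self_nonneg])
  fix x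
  have "0 \<le> L2inner T (\<lambda>t. 1 * f t + x * g t) (\<lambda>t. 1 * f t + x * g t)"
    by (rule L2inner_self_nonneg)
  also have "\<dots> = L2inner T f f + 2 * x * L2inner T f g + x\<^sup>2 * L2inner T g g"
    using assms by (simp only: L2inner_lincomb_left L2inner_lincomb_right L2_lincomb)
      (simp add: L2inner_commute[of T g f] power2_eq_square algebra_simps)
  finally show "0 \<le> L2inner T f f + 2 * x * L2inner T f g + x\<^sup>2 * L2inner T g g" .
qed

lemma integral_Cauchy_Schwarz:
  fixes X Y :: "'a \<Rightarrow> real"
  assumes [measurable]: "X \<in> borel_measurable M" "Y \<in> borel_measurable M"
    and X2: "integrable M (\<lambda>w. (X w)\<^sup>2)" and Y2: "integrable M (\<lambda>w. (Y w)\<^sup>2)"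
  shows "(\<integral>w. X w * Y w \<partial>M)\<^sup>2 \<le> (\<integral>w. (X w)\<^sup>2 \<partial>M) * (\<integral>w. (Y w)\<^sup>2 \<partial>M)"
proof (rule quadratic_nonneg_imp_discriminant)
  show "0 \<le> (\<integral>w. (Y w)\<^sup>2 \<partial>M)"
    by (intro Bochner_Integration.integral_nonneg) simp
  fix x
  have XY: "integrable M (\<lambda>w. X w * Y w)"
  proof (rule Bochner_Integration.integrable_bound)
    show "integrable M (\<lambda>w. (X w)\<^sup>2 + (Y w)\<^sup>2)"
      using X2 Y2 by simp
    show "AE w in M. norm (X w * Y w) \<le> norm ((X w)\<^sup>2 + (Y w)\<^sup>2)"
      using abs_mult_le_sum_squares by simp
  qed simp
  have "0 \<le> (\<integral>w. (X w + x * Y w)\<^sup>2 \<partial>M)"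
    by (intro Bochner_Integration.integral_nonneg) simp
  also have "\<dots> = (\<integral>w. (X w)\<^sup>2 + 2 * x * (X w * Y w) + x\<^sup>2 * (Y w)\<^sup>2 \<partial>M)"
    by (simp add: power2_eq_square algebra_simps)
  also have "\<dots> = (\<integral>w. (X w)\<^sup>2 \<partial>M) + 2 * x * (\<integral>w. X w * Y w \<partial>M) + x\<^sup>2 * (\<integral>w. (Y w)\<^sup>2 \<partial>M)"
    using X2 Y2 XY by simp
  finally show "0 \<le> (\<integral>w. (X w)\<^sup>2 \<partial>M) + 2 * x * (\<integral>w. X w * Y w \<partial>M) + x\<^sup>2 * (\<integral>w. (Y w)\<^sup>2 \<partial>M)" .
qed

text \<open>The projection \<open>p\<close> of \<open>f\<close> onto the span satisfies
  \<open>\<langle>p, f\<rangle> = \<langle>p, p\<rangle>\<close>, both being the sum of squared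
  coefficients, so \<open>|f - p|\<^sup>2 \<ge> 0\<close> is the claim.\<close>

lemma L2inner_bessel:
  assumes "finite S" "\<And>i. i \<in> S \<Longrightarrow> e i \<in> L2 T" "f \<in> L2 T"
    and orth: "\<And>i j. i \<in> S \<Longrightarrow> j \<in> S \<Longrightarrow> L2inner T (e i) (e j) = (if i = j then 1 else 0)"
  shows "(\<Sum>i\<in>S. (L2inner T f (e i))\<^sup>2) \<le> L2inner T f f"
proof -
  let ?p = "\<lambda>t. \<Sum>i\<in>S. L2inner T f (e i) * e i t"
  let ?s = "\<Sum>i\<in>S. (L2inner T f (e i))\<^sup>2"
  have p: "?p \<in> L2 T" using assms by (intro L2_sum) auto
  have pf: "L2inner T ?p f = ?s"
    using assms by (subst L2inner_sum_left) (auto simp: L2inner_commute[of T _ f] power2_eq_square)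
  have pe: "L2inner T (e j) ?p = L2inner T f (e j)" if "j \<in> S" for j
  proof -
    have "L2inner T (e j) ?p = (\<Sum>i\<in>S. L2inner T f (e i) * L2inner T (e i) (e j))"
      using assms that by (subst L2inner_commute, subst L2inner_sum_left) auto
    also have "\<dots> = (\<Sum>i\<in>S. if i = j then L2inner T f (e i) else 0)"
      using that by (intro sum.cong) (auto simp: orth)
    finally show ?thesis using assms(1) that by simp
  qed
  have pp: "L2inner T ?p ?p = ?s"
    using assms(1-3) p by (subst L2inner_sum_left) (auto simp: pe power2_eq_square)
  have "0 \<le> L2inner T (\<lambda>t. f t - ?p t) (\<lambda>t. f t - ?p t)"
    by (rule L2inner_self_nonneg)
  also have "\<dots> = L2inner T f f - ?s"
    using p assms(3) L2_diff[OF assms(3) p] pf pp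
    by (simp add: L2inner_diff_left L2inner_diff_right L2inner_commute[of T f ?p])
  finally show ?thesis by simp
qed

section \<open>Gaussian integrals and measures determined by trigonometric integrals\<close>

text \<open>Links complex characteristic functions with the real cosine and sine integrals in which
  all later transforms are expressed.\<close>

lemma (in finite_measure) integral_iexp:
  assumes [measurable]: "X \<in> borel_measurable M"
  shows "(CLINT w|M. iexp (X w)) = Complex (\<integral>w. cos (X w) \<partial>M) (\<integral>w. sin (X w) \<partial>M)"
proof -
  have int: "integrable M (\<lambda>w. cis (X w))"
    by (rule integrable_const_bound[where B=1]) (auto simp: cis_conv_exp)
  show ?thesis
    using integral_Re[OF int] integral_Im[OF int] unfolding cis_conv_exp[symmetric]
    by (intro complex_eqI) simp_all
qed

lemma std_normal_integral_trig:
  "(\<integral>u. std_normal_density u * cos (c * u) \<partial>lborel) = exp (- c\<^sup>2 / 2)"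
  "(\<integral>u. std_normal_density u * sin (c * u) \<partial>lborel) = 0"
proof -
  interpret real_distribution std_normal_distribution
    by (rule real_dist_normal_dist)
  have "Complex (\<integral>u. cos (c * u) \<partial>std_normal_distribution) (\<integral>u. sin (c * u) \<partial>std_normal_distribution)
      = complex_of_real (exp (- c\<^sup>2 / 2))"
    using fun_cong[OF char_std_normal_distribution, of c] integral_iexp[of "\<lambda>u. c * u"]
    unfolding char_def by simp
  then have *: "(\<integral>u. cos (c * u) \<partial>std_normal_distribution) = exp (- c\<^sup>2 / 2)"
    "(\<integral>u. sin (c * u) \<partial>std_normal_distribution) = 0"
    by (simp_all add: complex_eq_iff)
  have "(\<integral>u. g u \<partial>std_normal_distribution) = (\<integral>u. std_normal_density u * g u \<partial>lborel)"
    if [measurable]: "g \<in> borel_measurable borel" for g :: "real \<Rightarrow> real"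
    by (subst integral_density) auto
  from this[of "\<lambda>u. cos (c * u)"] this[of "\<lambda>u. sin (c * u)"] * 
  show "(\<integral>u. std_normal_density u * cos (c * u) \<partial>lborel) = exp (- c\<^sup>2 / 2)"
    "(\<integral>u. std_normal_density u * sin (c * u) \<partial>lborel) = 0"
    by simp_all
qed

lemma normal_density_standardize:
  assumes "\<tau> > 0"
  shows "\<tau> * normal_density m \<tau> (m + \<tau> * u) = std_normal_density u"
  using assms by (simp add: normal_density_def real_sqrt_mult power_mult_distrib)

lemma normal_integral_trig:
  assumes \<tau>: "\<tau> > 0"
  shows "(\<integral>x. normal_density m \<tau> x * cos (t * x) \<partial>lborel) = exp (- t\<^sup>2 * \<tau>\<^sup>2 / 2) * cos (t * m)"
    and "(\<integral>x. normal_density m \<tau> x * sin (t * x) \<partial>lborel) = exp (- t\<^sup>2 * \<tau>\<^sup>2 / 2) * sin (t * m)"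
proof -
  have int: "integrable lborel (\<lambda>u. std_normal_density u * cos (c * u))"
    "integrable lborel (\<lambda>u. std_normal_density u * sin (c * u))" for c
    by (rule Bochner_Integration.integrable_bound[OF integrable_normal_density[of 1 0]];
        simp add: abs_mult mult_left_le)+
  have "(\<integral>x. normal_density m \<tau> x * cos (t * x) \<partial>lborel)
      = (\<integral>u. \<tau> * (normal_density m \<tau> (m + \<tau> * u) * cos (t * (m + \<tau> * u))) \<partial>lborel)"
    using \<tau> by (subst lborel_integral_real_affine[where c=\<tau> and t=m]) auto
  also have "\<dots> = (\<integral>u. cos (t * m) * (std_normal_density u * cos ((t * \<tau>) * u))
      - sin (t * m) * (std_normal_density u * sin ((t * \<tau>) * u)) \<partial>lborel)"
    by (intro Bochner_Integration.integral_cong refl,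
        simp only: mult.assoc[symmetric] normal_density_standardize[OF \<tau>])
      (simp add: cos_add algebra_simps)
  also have "\<dots> = exp (- t\<^sup>2 * \<tau>\<^sup>2 / 2) * cos (t * m)"
    using int std_normal_integral_trig by (simp add: power_mult_distrib)
  finally show "(\<integral>x. normal_density m \<tau> x * cos (t * x) \<partial>lborel) = exp (- t\<^sup>2 * \<tau>\<^sup>2 / 2) * cos (t * m)" .
  have "(\<integral>x. normal_density m \<tau> x * sin (t * x) \<partial>lborel)
      = (\<integral>u. \<tau> * (normal_density m \<tau> (m + \<tau> * u) * sin (t * (m + \<tau> * u))) \<partial>lborel)"
    using \<tau> by (subst lborel_integral_real_affine[where c=\<tau> and t=m]) auto
  also have "\<dots> = (\<integral>u. sin (t * m) * (std_normal_density u * cos ((t * \<tau>) * u))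
      + cos (t * m) * (std_normal_density u * sin ((t * \<tau>) * u)) \<partial>lborel)"
    by (intro Bochner_Integration.integral_cong refl,
        simp only: mult.assoc[symmetric] normal_density_standardize[OF \<tau>])
      (simp add: sin_add algebra_simps)
  also have "\<dots> = exp (- t\<^sup>2 * \<tau>\<^sup>2 / 2) * sin (t * m)"
    using int std_normal_integral_trig by (simp add: power_mult_distrib)
  finally show "(\<integral>x. normal_density m \<tau> x * sin (t * x) \<partial>lborel) = exp (- t\<^sup>2 * \<tau>\<^sup>2 / 2) * sin (t * m)" .
qed

text \<open>Completing the square: exponential tilting shifts the mean and keeps the variance. This
  is the Cameron--Martin theorem in dimension one.\<close>

lemma normal_density_exp_tilt:
  assumes "\<tau> > 0"
  shows "normal_density 0 \<tau> x * exp (s * x) = exp (s\<^sup>2 * \<tau>\<^sup>2 / 2) * normal_density (s * \<tau>\<^sup>2) \<tau> x"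
proof -
  have "- x\<^sup>2 / (2 * \<tau>\<^sup>2) + s * x = s\<^sup>2 * \<tau>\<^sup>2 / 2 + - (x - s * \<tau>\<^sup>2)\<^sup>2 / (2 * \<tau>\<^sup>2)"
    using assms by (simp add: field_simps power2_eq_square)
  then show ?thesis
    by (simp add: normal_density_def exp_add[symmetric])
qed

text \<open>These are the real and imaginary parts of
  \<open>E exp ((s + i t) X) = exp ((s + i t)\<^sup>2 v / 2)\<close>. The factor
  \<open>exp (s X)\<close> tilts the density to mean \<open>s v\<close>, where the trigonometric
  integrals are known. Taking \<open>s = 0\<close> gives the characteristic function and
  \<open>t = 0\<close> the exponential moments. A point mass has no density and is treated
  apart.\<close>

lemma (in prob_space) gaussian_rv_exp_trig:
  assumes X: "gaussian_rv M X 0 v"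
  shows "integrable M (\<lambda>w. exp (s * X w))"
    and "(\<integral>w. exp (s * X w) * cos (t * X w) \<partial>M) = exp ((s\<^sup>2 - t\<^sup>2) * v / 2) * cos (s * t * v)"
    and "(\<integral>w. exp (s * X w) * sin (t * X w) \<partial>M) = exp ((s\<^sup>2 - t\<^sup>2) * v / 2) * sin (s * t * v)"
proof -
  have [measurable]: "X \<in> borel_measurable M"
    using X by (simp add: gaussian_rv_def)
  consider (degenerate) "v = 0" "AE w in M. X w = 0"
    | (regular) "v > 0" "distributed M lborel X (normal_density 0 (sqrt v))"
    using X by (auto simp: gaussian_rv_def)
  then have "integrable M (\<lambda>w. exp (s * X w)) \<and>
     (\<integral>w. exp (s * X w) * cos (t * X w) \<partial>M) = exp ((s\<^sup>2 - t\<^sup>2) * v / 2) * cos (s * t * v) \<and>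
     (\<integral>w. exp (s * X w) * sin (t * X w) \<partial>M) = exp ((s\<^sup>2 - t\<^sup>2) * v / 2) * sin (s * t * v)"
  proof cases
    case degenerate
    have "integrable M (\<lambda>w. exp (s * X w)) \<longleftrightarrow> integrable M (\<lambda>w. 1 :: real)"
      using degenerate by (intro integrable_cong_AE) auto
    moreover have "(\<integral>w. exp (s * X w) * cos (t * X w) \<partial>M) = (\<integral>w. 1 \<partial>M)"
      "(\<integral>w. exp (s * X w) * sin (t * X w) \<partial>M) = (\<integral>w. 0 \<partial>M)"
      using degenerate by (intro integral_cong_AE; auto)+
    ultimately show ?thesis
      using degenerate by (simp add: prob_space)
  next
    case regular
    define \<tau> where "\<tau> = sqrt v"
    have \<tau>: "\<tau> > 0" "\<tau>\<^sup>2 = v" using regular by (auto simp: \<tau>_def)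
    have D: "distributed M lborel X (normal_density 0 \<tau>)"
      using regular by (simp add: \<tau>_def)
    have "integrable lborel (\<lambda>x. normal_density 0 \<tau> x * exp (s * x))"
      unfolding normal_density_exp_tilt[OF \<tau>(1)] using \<tau>(1) by simp
    then have "integrable M (\<lambda>w. exp (s * X w))"
      by (subst (asm) distributed_integrable[OF D]) auto
    moreover have "(\<integral>w. exp (s * X w) * g (t * X w) \<partial>M)
        = exp (s\<^sup>2 * \<tau>\<^sup>2 / 2) * (\<integral>x. normal_density (s * \<tau>\<^sup>2) \<tau> x * g (t * x) \<partial>lborel)"
      if [measurable]: "g \<in> borel_measurable borel" for g :: "real \<Rightarrow> real"
    proof -
      have "(\<integral>w. exp (s * X w) * g (t * X w) \<partial>M)
          = (\<integral>x. normal_density 0 \<tau> x * (exp (s * x) * g (t * x)) \<partial>lborel)"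
        by (subst distributed_integral[OF D]) auto
      then show ?thesis
        by (simp add: mult.assoc[symmetric] normal_density_exp_tilt[OF \<tau>(1)])
           (simp add: mult.assoc)
    qed
    ultimately show ?thesis
      using \<tau> by (simp add: normal_integral_trig mult.assoc[symmetric] exp_add[symmetric])
        (simp add: algebra_simps diff_divide_distrib)
  qed
  then show "integrable M (\<lambda>w. exp (s * X w))"
    "(\<integral>w. exp (s * X w) * cos (t * X w) \<partial>M) = exp ((s\<^sup>2 - t\<^sup>2) * v / 2) * cos (s * t * v)"
    "(\<integral>w. exp (s * X w) * sin (t * X w) \<partial>M) = exp ((s\<^sup>2 - t\<^sup>2) * v / 2) * sin (s * t * v)"
    by auto
qed

lemma (in prob_space) gaussian_rv_second_moment:
  assumes X: "gaussian_rv M X 0 v"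
  shows "integrable M (\<lambda>w. (X w)\<^sup>2)" and "(\<integral>w. (X w)\<^sup>2 \<partial>M) = v"
proof -
  have [measurable]: "X \<in> borel_measurable M"
    using X by (simp add: gaussian_rv_def)
  consider (degenerate) "v = 0" "AE w in M. X w = 0"
    | (regular) "v > 0" "distributed M lborel X (normal_density 0 (sqrt v))"
    using X by (auto simp: gaussian_rv_def)
  then have "integrable M (\<lambda>w. (X w)\<^sup>2) \<and> (\<integral>w. (X w)\<^sup>2 \<partial>M) = v"
  proof cases
    case degenerate
    have "integrable M (\<lambda>w. (X w)\<^sup>2) \<longleftrightarrow> integrable M (\<lambda>w. 0 :: real)"
      using degenerate by (intro integrable_cong_AE) auto
    moreover have "(\<integral>w. (X w)\<^sup>2 \<partial>M) = (\<integral>w. 0 \<partial>M)"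
      using degenerate by (intro integral_cong_AE) auto
    ultimately show ?thesis
      using degenerate by simp
  next
    case regular
    have *: "has_bochner_integral lborel (\<lambda>x. normal_density 0 (sqrt v) x * x\<^sup>2) v"
      using normal_moment_even[of "sqrt v" 0 1] regular by (simp add: fact_numeral)
    have "integrable M (\<lambda>w. (X w)\<^sup>2)"
      using has_bochner_integral_integral_eq[OF *] integrable.intros[OF *]
      by (subst (asm) distributed_integrable[OF regular(2)]) auto
    moreover have "(\<integral>w. (X w)\<^sup>2 \<partial>M) = v"
      using has_bochner_integral_integral_eq[OF *]
      by (subst (asm) distributed_integral[OF regular(2)]) auto
    ultimately show ?thesis ..
  qed
  then show "integrable M (\<lambda>w. (X w)\<^sup>2)" "(\<integral>w. (X w)\<^sup>2 \<partial>M) = v"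
    by auto
qed

section \<open>Finite measures on the line determined by cosine and sine integrals\<close>

lemma (in finite_measure) integrable_bounded_trig [simp, intro]:
  fixes X :: "'a \<Rightarrow> real"
  assumes [measurable]: "X \<in> borel_measurable M"
  shows "integrable M (\<lambda>w. cos (X w))" "integrable M (\<lambda>w. sin (X w))"
  by (rule integrable_const_bound[where B=1]; auto)+

text \<open>Levy's uniqueness theorem concerns probability laws, so both measures are divided by
  their total mass \<open>m\<close>; the cosine integral at \<open>t = 0\<close> shows that this
  mass is common. If \<open>m = 0\<close>, both measures vanish.\<close>

lemma finite_measure_eqI_trig:
  fixes \<mu> \<nu> :: "real measure"
  assumes "finite_measure \<mu>" "finite_measure \<nu>"
    and sets [measurable_cong]: "sets \<mu> = sets borel" "sets \<nu> = sets borel"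
    and cos: "\<And>t. (\<integral>x. cos (t * x) \<partial>\<mu>) = (\<integral>x. cos (t * x) \<partial>\<nu>)"
    and sin: "\<And>t. (\<integral>x. sin (t * x) \<partial>\<mu>) = (\<integral>x. sin (t * x) \<partial>\<nu>)"
  shows "\<mu> = \<nu>"
proof -
  interpret \<mu>: finite_measure \<mu> by fact
  interpret \<nu>: finite_measure \<nu> by fact
  have [simp]: "space \<mu> = UNIV" "space \<nu> = UNIV"
    using sets_eq_imp_space_eq[OF sets(1)] sets_eq_imp_space_eq[OF sets(2)] by auto
  define m where "m = measure \<mu> UNIV"
  have m: "measure \<nu> UNIV = m"
    using cos[of 0] by (simp add: m_def)
  show ?thesis
  proof (cases "m = 0")
    case True
    show ?thesis
    proof (rule measure_eqI)
      fix A
      have "measure \<mu> A = 0" "measure \<nu> A = 0"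
        using \<mu>.bounded_measure[of A] \<nu>.bounded_measure[of A] m True
        by (auto simp: m_def measure_le_0_iff)
      then show "emeasure \<mu> A = emeasure \<nu> A"
        by (simp add: \<mu>.emeasure_eq_measure \<nu>.emeasure_eq_measure)
    qed (simp add: sets)
  next
    case False
    then have mpos: "m > 0" by (simp add: m_def zero_less_measure_iff order.not_eq_order_implies_strict)
    let ?d = "\<lambda>\<kappa> :: real measure. density \<kappa> (\<lambda>_. ennreal (1 / m))"
    have rd: "real_distribution (?d \<kappa>)"
      if "finite_measure \<kappa>" "sets \<kappa> = sets borel" "measure \<kappa> UNIV = m" for \<kappa>
    proof -
      interpret \<kappa>: finite_measure \<kappa> by fact
      have [simp]: "space \<kappa> = UNIV"
        using sets_eq_imp_space_eq[OF that(2)] by simp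
      have "emeasure (?d \<kappa>) (space (?d \<kappa>)) = ennreal (1 / m) * ennreal m"
        using that by (simp add: emeasure_density_const \<kappa>.emeasure_eq_measure)
      also have "\<dots> = 1"
        using mpos by (simp flip: ennreal_mult)
      finally show ?thesis
        using that by (intro real_distribution.intro prob_spaceI) (auto simp: real_distribution_axioms_def)
    qed
    have ch: "char (?d \<kappa>) t = complex_of_real (1 / m) *
        Complex (\<integral>x. cos (t * x) \<partial>\<kappa>) (\<integral>x. sin (t * x) \<partial>\<kappa>)"
      if "finite_measure \<kappa>" and [measurable_cong]: "sets \<kappa> = sets borel" for \<kappa> t
    proof -
      interpret \<kappa>: finite_measure \<kappa> by fact
      have "char (?d \<kappa>) t = (CLINT x|\<kappa>. (1 / m) *\<^sub>R iexp (t * x))"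
        unfolding char_def using mpos by (subst integral_density) auto
      also have "\<dots> = complex_of_real (1 / m) * (CLINT x|\<kappa>. iexp (t * x))"
        by (simp add: scaleR_conv_of_real)
      also have "(CLINT x|\<kappa>. iexp (t * x)) = Complex (\<integral>x. cos (t * x) \<partial>\<kappa>) (\<integral>x. sin (t * x) \<partial>\<kappa>)"
        by (rule \<kappa>.integral_iexp) simp
      finally show ?thesis .
    qed
    have "?d \<mu> = ?d \<nu>"
    proof (rule Levy_uniqueness)
      show "char (?d \<mu>) = char (?d \<nu>)"
        using assms by (intro ext) (simp add: ch)
    qed (rule rd; simp add: assms m m_def[symmetric])+
    then have "ennreal (1 / m) * emeasure \<mu> A = ennreal (1 / m) * emeasure \<nu> A" if "A \<in> sets borel" for A
      using that sets by (simp flip: emeasure_density_const)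
    then show ?thesis
      using mpos by (intro measure_eqI) (auto simp: sets ennreal_mult_cancel_left)
  qed
qed

lemma finite_measure_density_bounded:
  assumes "finite_measure P" and [measurable]: "G \<in> borel_measurable P"
    and G: "\<And>w. 0 \<le> G w" "\<And>w. G w \<le> B"
  shows "finite_measure (density P (\<lambda>w. ennreal (G w)))"
proof
  interpret P: finite_measure P by fact
  have "integrable P G" using G by (intro P.integrable_const_bound[where B=B]) auto
  then show "emeasure (density P (\<lambda>w. ennreal (G w))) (space (density P (\<lambda>w. ennreal (G w)))) \<noteq> \<infinity>"
    using G by (simp add: emeasure_density nn_integral_eq_integral cong: nn_integral_cong_simp)
qed

text \<open>The weights act as densities: the image of \<open>G1 P1\<close> under \<open>X1\<close>
  and that of \<open>G2 P2\<close> under \<open>X2\<close> are finite measures with the same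
  transforms, hence equal. Both sides integrate \<open>F\<close> over this one measure, so unbounded
  \<open>F\<close> are covered too.\<close>

lemma weighted_integral_eq_if_trig_eq:
  fixes X1 :: "'a \<Rightarrow> real" and X2 :: "'b \<Rightarrow> real"
  assumes "finite_measure P1" "finite_measure P2"
    and [measurable]: "X1 \<in> borel_measurable P1" "X2 \<in> borel_measurable P2"
    and [measurable]: "G1 \<in> borel_measurable P1" "G2 \<in> borel_measurable P2"
    and G1: "\<And>w. 0 \<le> G1 w" "\<And>w. G1 w \<le> B" and G2: "\<And>w. 0 \<le> G2 w" "\<And>w. G2 w \<le> B"
    and cos: "\<And>t. (\<integral>w. G1 w * cos (t * X1 w) \<partial>P1) = (\<integral>w. G2 w * cos (t * X2 w) \<partial>P2)"
    and sin: "\<And>t. (\<integral>w. G1 w * sin (t * X1 w) \<partial>P1) = (\<integral>w. G2 w * sin (t * X2 w) \<partial>P2)"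
    and F [measurable]: "F \<in> borel_measurable borel"
  shows "(\<integral>w. G1 w * F (X1 w) \<partial>P1) = (\<integral>w. G2 w * (F (X2 w) :: real) \<partial>P2)"
proof -
  interpret P1: finite_measure P1 by fact
  interpret P2: finite_measure P2 by fact
  let ?d1 = "distr (density P1 (\<lambda>w. ennreal (G1 w))) borel X1"
  let ?d2 = "distr (density P2 (\<lambda>w. ennreal (G2 w))) borel X2"
  have i1: "(\<integral>x. f x \<partial>?d1) = (\<integral>w. G1 w * f (X1 w) \<partial>P1)"
    if [measurable]: "f \<in> borel_measurable borel" for f :: "real \<Rightarrow> real"
    using G1 by (simp add: integral_distr integral_density)
  have i2: "(\<integral>x. f x \<partial>?d2) = (\<integral>w. G2 w * f (X2 w) \<partial>P2)"
    if [measurable]: "f \<in> borel_measurable borel" for f :: "real \<Rightarrow> real"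
    using G2 by (simp add: integral_distr integral_density)
  have "finite_measure (density P1 (\<lambda>w. ennreal (G1 w)))"
    using G1 by (intro finite_measure_density_bounded assms) auto
  then have f1: "finite_measure ?d1" by (rule finite_measure.finite_measure_distr) simp
  have "finite_measure (density P2 (\<lambda>w. ennreal (G2 w)))"
    using G2 by (intro finite_measure_density_bounded assms) auto
  then have f2: "finite_measure ?d2" by (rule finite_measure.finite_measure_distr) simp
  have "?d1 = ?d2"
    by (rule finite_measure_eqI_trig[OF f1 f2]) (simp_all only: sets_distr, simp_all add: i1 i2 cos sin)
  then show ?thesis
    using i1[OF F] i2[OF F] by simp
qed

section \<open>From transforms of linear combinations to joint laws\<close>

lemma one_plus_trig_bounds: "0 \<le> 1 + cos x" "1 + cos x \<le> 2" "0 \<le> 1 + sin x" "1 + sin x \<le> 2" for x :: real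
  using cos_le_one[of x] cos_ge_minus_one[of x] sin_le_one[of x] sin_ge_minus_one[of x] by linarith+

text \<open>Expanding the weights \<open>1 + cos Y\<close> and \<open>1 + sin Y\<close> makes the transform of the weighted law
  of \<open>X\<close> a combination of transforms of the linear combinations \<open>t X + Y\<close>, while keeping the
  weights nonnegative so that Levy's uniqueness theorem applies.\<close>

lemma (in finite_measure) integral_trig_weight:
  fixes X Y :: "'a \<Rightarrow> real"
  assumes [measurable]: "X \<in> borel_measurable M" "Y \<in> borel_measurable M"
  shows "(\<integral>w. (1 + cos (Y w)) * cos (t * X w) \<partial>M) = (\<integral>w. cos (t * X w) \<partial>M)
      + ((\<integral>w. cos (t * X w + Y w) \<partial>M) + (\<integral>w. cos ((- t) * X w + Y w) \<partial>M)) / 2"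
    and "(\<integral>w. (1 + cos (Y w)) * sin (t * X w) \<partial>M) = (\<integral>w. sin (t * X w) \<partial>M)
      + ((\<integral>w. sin (t * X w + Y w) \<partial>M) - (\<integral>w. sin ((- t) * X w + Y w) \<partial>M)) / 2"
    and "(\<integral>w. (1 + sin (Y w)) * cos (t * X w) \<partial>M) = (\<integral>w. cos (t * X w) \<partial>M)
      + ((\<integral>w. sin (t * X w + Y w) \<partial>M) + (\<integral>w. sin ((- t) * X w + Y w) \<partial>M)) / 2"
    and "(\<integral>w. (1 + sin (Y w)) * sin (t * X w) \<partial>M) = (\<integral>w. sin (t * X w) \<partial>M)
      + ((\<integral>w. cos ((- t) * X w + Y w) \<partial>M) - (\<integral>w. cos (t * X w + Y w) \<partial>M)) / 2"
proof -
  have "(1 + cos y) * cos (t * x) = cos (t * x) + (cos (t * x + y) + cos ((- t) * x + y)) / 2"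
    "(1 + cos y) * sin (t * x) = sin (t * x) + (sin (t * x + y) - sin ((- t) * x + y)) / 2"
    "(1 + sin y) * cos (t * x) = cos (t * x) + (sin (t * x + y) + sin ((- t) * x + y)) / 2"
    "(1 + sin y) * sin (t * x) = sin (t * x) + (cos ((- t) * x + y) - cos (t * x + y)) / 2" for x y :: real
    by (simp_all add: cos_add sin_add cos_diff sin_diff algebra_simps)
  note eqs = this
  have int: "integrable M (\<lambda>w. cos (s * X w + r * Y w))" "integrable M (\<lambda>w. sin (s * X w + r * Y w))" for s r
    by auto
  note int' = int[of t 1] int[of "-t" 1] int[of t 0]
  show "(\<integral>w. (1 + cos (Y w)) * cos (t * X w) \<partial>M) = (\<integral>w. cos (t * X w) \<partial>M)
      + ((\<integral>w. cos (t * X w + Y w) \<partial>M) + (\<integral>w. cos ((- t) * X w + Y w) \<partial>M)) / 2"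
    unfolding eqs using int' by simp
  show "(\<integral>w. (1 + cos (Y w)) * sin (t * X w) \<partial>M) = (\<integral>w. sin (t * X w) \<partial>M)
      + ((\<integral>w. sin (t * X w + Y w) \<partial>M) - (\<integral>w. sin ((- t) * X w + Y w) \<partial>M)) / 2"
    unfolding eqs using int' by simp
  show "(\<integral>w. (1 + sin (Y w)) * cos (t * X w) \<partial>M) = (\<integral>w. cos (t * X w) \<partial>M)
      + ((\<integral>w. sin (t * X w + Y w) \<partial>M) + (\<integral>w. sin ((- t) * X w + Y w) \<partial>M)) / 2"
    unfolding eqs using int' by simp
  show "(\<integral>w. (1 + sin (Y w)) * sin (t * X w) \<partial>M) = (\<integral>w. sin (t * X w) \<partial>M)
      + ((\<integral>w. cos ((- t) * X w + Y w) \<partial>M) - (\<integral>w. cos (t * X w + Y w) \<partial>M)) / 2"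
    unfolding eqs using int' by simp
qed

text \<open>The weights 1, \<open>1 + cos Y\<close> and \<open>1 + sin Y\<close> each give equal
  integrals of the indicator; subtracting the first equality from the other two leaves the claim. It
  is the step that adds one coordinate event in the comparison of observation laws.\<close>

lemma integral_indicator_trig_eq:
  fixes X1 Y1 :: "'a \<Rightarrow> real" and X2 Y2 :: "'b \<Rightarrow> real"
  assumes "finite_measure P1" "finite_measure P2"
    and [measurable]: "X1 \<in> borel_measurable P1" "Y1 \<in> borel_measurable P1"
      "X2 \<in> borel_measurable P2" "Y2 \<in> borel_measurable P2"
    and X: "\<And>t. (\<integral>w. cos (t * X1 w) \<partial>P1) = (\<integral>w. cos (t * X2 w) \<partial>P2)"
      "\<And>t. (\<integral>w. sin (t * X1 w) \<partial>P1) = (\<integral>w. sin (t * X2 w) \<partial>P2)"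
    and XY: "\<And>t. (\<integral>w. cos (t * X1 w + Y1 w) \<partial>P1) = (\<integral>w. cos (t * X2 w + Y2 w) \<partial>P2)"
      "\<And>t. (\<integral>w. sin (t * X1 w + Y1 w) \<partial>P1) = (\<integral>w. sin (t * X2 w + Y2 w) \<partial>P2)"
    and A: "A \<in> sets borel"
  shows "(\<integral>w. indicator A (X1 w) * cos (Y1 w) \<partial>P1) = (\<integral>w. indicator A (X2 w) * cos (Y2 w) \<partial>P2)"
    and "(\<integral>w. indicator A (X1 w) * sin (Y1 w) \<partial>P1) = (\<integral>w. indicator A (X2 w) * sin (Y2 w) \<partial>P2)"
proof -
  interpret P1: finite_measure P1 by fact
  interpret P2: finite_measure P2 by fact
  let ?I = "indicator A :: real \<Rightarrow> real"
  have [measurable]: "?I \<in> borel_measurable borel" using A by simp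
  note tw = P1.integral_trig_weight[OF assms(3,4)] P2.integral_trig_weight[OF assms(5,6)]
  have 1: "(\<integral>w. 1 * ?I (X1 w) \<partial>P1) = (\<integral>w. 1 * ?I (X2 w) \<partial>P2)"
    by (rule weighted_integral_eq_if_trig_eq[OF assms(1,2), where F="?I" and ?X1.0=X1 and ?X2.0=X2 and B=1]) (simp_all add: X)
  have c: "(\<integral>w. (1 + cos (Y1 w)) * ?I (X1 w) \<partial>P1) = (\<integral>w. (1 + cos (Y2 w)) * ?I (X2 w) \<partial>P2)"
    by (rule weighted_integral_eq_if_trig_eq[OF assms(1,2), where F="?I" and ?X1.0=X1 and ?X2.0=X2 and B=2])
      (simp_all only: tw X XY, simp_all add: one_plus_trig_bounds)
  have s: "(\<integral>w. (1 + sin (Y1 w)) * ?I (X1 w) \<partial>P1) = (\<integral>w. (1 + sin (Y2 w)) * ?I (X2 w) \<partial>P2)"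
    by (rule weighted_integral_eq_if_trig_eq[OF assms(1,2), where F="?I" and ?X1.0=X1 and ?X2.0=X2 and B=2])
      (simp_all only: tw X XY, simp_all add: one_plus_trig_bounds)
  have int1: "integrable P1 (\<lambda>w. ?I (X1 w))" "integrable P1 (\<lambda>w. ?I (X1 w) * cos (Y1 w))"
    "integrable P1 (\<lambda>w. ?I (X1 w) * sin (Y1 w))"
    by (rule P1.integrable_const_bound[where B=1], rule AE_I2, simp split: split_indicator, simp)+
  have int2: "integrable P2 (\<lambda>w. ?I (X2 w))" "integrable P2 (\<lambda>w. ?I (X2 w) * cos (Y2 w))"
    "integrable P2 (\<lambda>w. ?I (X2 w) * sin (Y2 w))"
    by (rule P2.integrable_const_bound[where B=1], rule AE_I2, simp split: split_indicator, simp)+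
  have e: "(1 + a) * b = b + b * a" for a b :: real by (simp add: algebra_simps)
  show "(\<integral>w. ?I (X1 w) * cos (Y1 w) \<partial>P1) = (\<integral>w. ?I (X2 w) * cos (Y2 w) \<partial>P2)"
    using c 1 int1 int2 unfolding e by simp
  show "(\<integral>w. ?I (X1 w) * sin (Y1 w) \<partial>P1) = (\<integral>w. ?I (X2 w) * sin (Y2 w) \<partial>P2)"
    using s 1 int1 int2 unfolding e by simp
qed

text \<open>The factorised transforms say that weighting by \<open>1 + cos Y\<close> has the same
  effect on the law of \<open>X\<close> as weighting by its mean, and likewise for
  \<open>1 + sin Y\<close>, whose mean is 1. Only the frequency 1 of \<open>Y\<close> is involved,
  which is less than full independence.\<close>

lemma (in prob_space) integral_mult_trig_indep:
  fixes X Y :: "'a \<Rightarrow> real"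
  assumes [measurable]: "X \<in> borel_measurable M" "Y \<in> borel_measurable M"
    and even: "\<And>t. (\<integral>w. cos ((- t) * X w) \<partial>M) = (\<integral>w. cos (t * X w) \<partial>M)"
    and X: "\<And>t. (\<integral>w. sin (t * X w) \<partial>M) = 0"
    and XY: "\<And>t. (\<integral>w. cos (t * X w + Y w) \<partial>M) = (\<integral>w. cos (t * X w) \<partial>M) * (\<integral>w. cos (Y w) \<partial>M)"
      "\<And>t. (\<integral>w. sin (t * X w + Y w) \<partial>M) = 0"
    and F [measurable]: "F \<in> borel_measurable borel" and int: "integrable M (\<lambda>w. F (X w))"
  shows "(\<integral>w. F (X w) * cos (Y w) \<partial>M) = (\<integral>w. F (X w) \<partial>M) * (\<integral>w. cos (Y w) \<partial>M)"
    and "(\<integral>w. F (X w) * sin (Y w) \<partial>M) = 0"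
proof -
  define c where "c = (\<integral>w. cos (Y w) \<partial>M)"
  \<comment> \<open>Makes the constant \<open>1 + c\<close> an admissible weight, with values
    between 0 and 2.\<close>
  have "\<bar>c\<bar> \<le> 1"
  proof -
    have "norm (\<integral>w. cos (Y w) \<partial>M) \<le> (\<integral>w. norm (cos (Y w)) \<partial>M)" by simp
    also have "\<dots> \<le> (\<integral>w. 1 \<partial>M)" by (intro integral_mono) auto
    finally show ?thesis by (simp add: c_def prob_space)
  qed
  then have c: "0 \<le> 1 + c" "1 + c \<le> 2" by auto
  have 1: "(\<integral>w. (1 + cos (Y w)) * F (X w) \<partial>M) = (\<integral>w. (1 + c) * F (X w) \<partial>M)"
    by (rule weighted_integral_eq_if_trig_eq[OF finite_measure_axioms finite_measure_axioms,
        where F=F and ?X1.0=X and ?X2.0=X and B=2])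
      (simp_all only: integral_trig_weight[OF assms(1,2)] XY X even c_def[symmetric], simp_all add: one_plus_trig_bounds c X algebra_simps)
  have 2: "(\<integral>w. (1 + sin (Y w)) * F (X w) \<partial>M) = (\<integral>w. 1 * F (X w) \<partial>M)"
    by (rule weighted_integral_eq_if_trig_eq[OF finite_measure_axioms finite_measure_axioms,
        where F=F and ?X1.0=X and ?X2.0=X and B=2])
      (simp_all only: integral_trig_weight[OF assms(1,2)] XY X even c_def[symmetric], simp_all add: one_plus_trig_bounds X)
  have i: "integrable M (\<lambda>w. F (X w) * cos (Y w))" "integrable M (\<lambda>w. F (X w) * sin (Y w))"
    by (rule Bochner_Integration.integrable_bound[OF int]; simp add: abs_mult mult_left_le)+
  have e: "(1 + a) * b = b + b * a" for a b :: real by (simp add: algebra_simps)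
  show "(\<integral>w. F (X w) * cos (Y w) \<partial>M) = (\<integral>w. F (X w) \<partial>M) * (\<integral>w. cos (Y w) \<partial>M)"
    using 1 int i unfolding e c_def[symmetric] by simp
  show "(\<integral>w. F (X w) * sin (Y w) \<partial>M) = 0"
    using 2 int i unfolding e by simp
qed

text \<open>A Cramer--Wold argument: fixing one coordinate event at a time keeps the equality of
  transforms of all remaining linear functionals.\<close>

lemma distr_eq_if_linear_functionals_eq:
  fixes Y1 :: "'a \<Rightarrow> (real \<Rightarrow> real) \<Rightarrow> real" and Y2 :: "'b \<Rightarrow> (real \<Rightarrow> real) \<Rightarrow> real"
  assumes fin: "finite_measure P1" "finite_measure P2"
    and Y1 [measurable]: "\<And>f. f \<in> L2 T \<Longrightarrow> (\<lambda>w. Y1 w f) \<in> borel_measurable P1"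
    and Y2 [measurable]: "\<And>f. f \<in> L2 T \<Longrightarrow> (\<lambda>w. Y2 w f) \<in> borel_measurable P2"
    and lin1: "\<And>f g a b. f \<in> L2 T \<Longrightarrow> g \<in> L2 T \<Longrightarrow>
        AE w in P1. Y1 w (\<lambda>t. a * f t + b * g t) = a * Y1 w f + b * Y1 w g"
    and lin2: "\<And>f g a b. f \<in> L2 T \<Longrightarrow> g \<in> L2 T \<Longrightarrow>
        AE w in P2. Y2 w (\<lambda>t. a * f t + b * g t) = a * Y2 w f + b * Y2 w g"
    and cos: "\<And>f. f \<in> L2 T \<Longrightarrow> (\<integral>w. cos (Y1 w f) \<partial>P1) = (\<integral>w. cos (Y2 w f) \<partial>P2)"
    and sin: "\<And>f. f \<in> L2 T \<Longrightarrow> (\<integral>w. sin (Y1 w f) \<partial>P1) = (\<integral>w. sin (Y2 w f) \<partial>P2)"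
  shows "distr P1 (PiM (L2 T) (\<lambda>_. borel)) (\<lambda>w. restrict (Y1 w) (L2 T))
       = distr P2 (PiM (L2 T) (\<lambda>_. borel)) (\<lambda>w. restrict (Y2 w) (L2 T))"
proof (rule measure_eqI_PiM_infinite)
  interpret P1: finite_measure P1 by fact
  interpret P2: finite_measure P2 by fact
  have [measurable]: "(\<lambda>w. restrict (Y1 w) (L2 T)) \<in> measurable P1 (PiM (L2 T) (\<lambda>_. borel))"
    by (rule measurable_restrict) (rule Y1)
  have [measurable]: "(\<lambda>w. restrict (Y2 w) (L2 T)) \<in> measurable P2 (PiM (L2 T) (\<lambda>_. borel))"
    by (rule measurable_restrict) (rule Y2)
  show "finite_measure (distr P1 (PiM (L2 T) (\<lambda>_. borel)) (\<lambda>w. restrict (Y1 w) (L2 T)))"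
    by (rule P1.finite_measure_distr) simp
  fix A :: "(real \<Rightarrow> real) \<Rightarrow> real set" and J
  assume J: "finite J" "J \<subseteq> L2 T" and A: "\<And>i. i \<in> J \<Longrightarrow> A i \<in> sets borel"
  \<comment> \<open>Indicator of the coordinate events with index in \<open>K\<close>, used as a
    density to restrict the measure to them.\<close>
  define G1 where "G1 K w = (\<Prod>j\<in>K. indicator (A j) (Y1 w j) :: real)" for K w
  define G2 where "G2 K w = (\<Prod>j\<in>K. indicator (A j) (Y2 w j) :: real)" for K w
  have bnd: "0 \<le> G1 K w" "G1 K w \<le> 1" for K w
    unfolding G1_def by (auto intro!: prod_nonneg prod_le_1 simp: indicator_def)
  have bnd2: "0 \<le> G2 K w" "G2 K w \<le> 1" for K w
    unfolding G2_def by (auto intro!: prod_nonneg prod_le_1 simp: indicator_def)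
  have mG1: "G1 K \<in> borel_measurable P1" if "K \<subseteq> J" for K
    unfolding G1_def using that J A by (intro borel_measurable_prod) (auto intro!: measurable_compose[OF Y1])
  have mG2: "G2 K \<in> borel_measurable P2" if "K \<subseteq> J" for K
    unfolding G2_def using that J A by (intro borel_measurable_prod) (auto intro!: measurable_compose[OF Y2])
  \<comment> \<open>Quantifying over all \<open>\<psi>\<close> gives an induction hypothesis that
    applies to every combination of the new coordinate \<open>\<phi>\<close> with a further test
    function.\<close>
  have main: "\<forall>\<psi>\<in>L2 T. (\<integral>w. G1 J w * cos (Y1 w \<psi>) \<partial>P1) = (\<integral>w. G2 J w * cos (Y2 w \<psi>) \<partial>P2)
      \<and> (\<integral>w. G1 J w * sin (Y1 w \<psi>) \<partial>P1) = (\<integral>w. G2 J w * sin (Y2 w \<psi>) \<partial>P2)"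
    using J(1) subset_refl[of J]
  proof (induction J rule: finite_subset_induct')
    case empty
    then show ?case by (simp add: G1_def G2_def cos sin)
  next
    case (insert \<phi> K)
    note [measurable] = mG1[OF insert.hyps(3)] mG2[OF insert.hyps(3)]
    have \<phi>: "\<phi> \<in> L2 T" using insert J by auto
    let ?Q1 = "density P1 (\<lambda>w. ennreal (G1 K w))"
    let ?Q2 = "density P2 (\<lambda>w. ennreal (G2 K w))"
    have f: "finite_measure ?Q1" "finite_measure ?Q2"
      using bnd bnd2 by (auto intro!: finite_measure_density_bounded fin)
    have ins1: "G1 (insert \<phi> K) w = G1 K w * indicator (A \<phi>) (Y1 w \<phi>)" for w
      using insert by (simp add: G1_def)
    have ins2: "G2 (insert \<phi> K) w = G2 K w * indicator (A \<phi>) (Y2 w \<phi>)" for w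
      using insert by (simp add: G2_def)
    have i1: "(\<integral>w. u w \<partial>?Q1) = (\<integral>w. G1 K w * u w \<partial>P1)" if "u \<in> borel_measurable P1" for u :: "'a \<Rightarrow> real"
      using that bnd by (simp add: integral_density)
    have i2: "(\<integral>w. u w \<partial>?Q2) = (\<integral>w. G2 K w * u w \<partial>P2)" if "u \<in> borel_measurable P2" for u :: "'b \<Rightarrow> real"
      using that bnd2 by (simp add: integral_density)
    have IH: "(\<integral>w. cos (t * Y1 w \<phi> + s * Y1 w \<psi>) \<partial>?Q1) = (\<integral>w. cos (t * Y2 w \<phi> + s * Y2 w \<psi>) \<partial>?Q2)"
      "(\<integral>w. sin (t * Y1 w \<phi> + s * Y1 w \<psi>) \<partial>?Q1) = (\<integral>w. sin (t * Y2 w \<phi> + s * Y2 w \<psi>) \<partial>?Q2)"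
      if \<psi>: "\<psi> \<in> L2 T" for t s \<psi>
    proof -
      let ?f = "\<lambda>x. t * \<phi> x + s * \<psi> x"
      note [measurable] = Y1[OF \<phi>] Y2[OF \<phi>] Y1[OF \<psi>] Y2[OF \<psi>]
      have L: "?f \<in> L2 T" using \<phi> \<psi> by (rule L2_lincomb)
      note [measurable] = Y1[OF L] Y2[OF L]
      \<comment> \<open>Almost sure linearity merges the two coordinates into the single coordinate
        \<open>?f\<close>, to which the induction hypothesis applies.\<close>
      have "(\<integral>w. G1 K w * g (t * Y1 w \<phi> + s * Y1 w \<psi>) \<partial>P1) = (\<integral>w. G1 K w * g (Y1 w ?f) \<partial>P1)"
        if [measurable]: "g \<in> borel_measurable borel" for g :: "real \<Rightarrow> real"
        by (rule integral_cong_AE) (use lin1[OF \<phi> \<psi>, of t s] in auto)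
      moreover have "(\<integral>w. G2 K w * g (t * Y2 w \<phi> + s * Y2 w \<psi>) \<partial>P2) = (\<integral>w. G2 K w * g (Y2 w ?f) \<partial>P2)"
        if [measurable]: "g \<in> borel_measurable borel" for g :: "real \<Rightarrow> real"
        by (rule integral_cong_AE) (use lin2[OF \<phi> \<psi>, of t s] in auto)
      ultimately show
        "(\<integral>w. cos (t * Y1 w \<phi> + s * Y1 w \<psi>) \<partial>?Q1) = (\<integral>w. cos (t * Y2 w \<phi> + s * Y2 w \<psi>) \<partial>?Q2)"
        "(\<integral>w. sin (t * Y1 w \<phi> + s * Y1 w \<psi>) \<partial>?Q1) = (\<integral>w. sin (t * Y2 w \<phi> + s * Y2 w \<psi>) \<partial>?Q2)"
        using bspec[OF insert.IH L] by (simp_all add: i1 i2)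
    qed
    show ?case
    proof
      fix \<psi> assume \<psi>: "\<psi> \<in> L2 T"
      note [measurable] = Y1[OF \<phi>] Y2[OF \<phi>] Y1[OF \<psi>] Y2[OF \<psi>]
      have A\<phi> [measurable]: "A \<phi> \<in> sets borel" using A insert by auto
      have "(\<integral>w. indicator (A \<phi>) (Y1 w \<phi>) * cos (Y1 w \<psi>) \<partial>?Q1) = (\<integral>w. indicator (A \<phi>) (Y2 w \<phi>) * cos (Y2 w \<psi>) \<partial>?Q2)"
        "(\<integral>w. indicator (A \<phi>) (Y1 w \<phi>) * sin (Y1 w \<psi>) \<partial>?Q1) = (\<integral>w. indicator (A \<phi>) (Y2 w \<phi>) * sin (Y2 w \<psi>) \<partial>?Q2)"
        by (rule integral_indicator_trig_eq[OF f _ _ _ _ _ _ _ _ A\<phi>];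
            use IH[OF \<psi>, of _ 0] IH[OF \<psi>, of _ 1] in simp)+
      then show "(\<integral>w. G1 (insert \<phi> K) w * cos (Y1 w \<psi>) \<partial>P1) = (\<integral>w. G2 (insert \<phi> K) w * cos (Y2 w \<psi>) \<partial>P2)
        \<and> (\<integral>w. G1 (insert \<phi> K) w * sin (Y1 w \<psi>) \<partial>P1) = (\<integral>w. G2 (insert \<phi> K) w * sin (Y2 w \<psi>) \<partial>P2)"
        by (simp add: i1 i2 ins1 ins2 mult.assoc)
    qed
  qed
  \<comment> \<open>The zero function has coordinate 0 almost surely, so its cosine is 1 and
    \<open>main\<close> yields the probabilities of the cylinder sets themselves.\<close>
  have z: "(\<lambda>t. 0) \<in> L2 T" by (rule L2_zero)
  note [measurable] = Y1[OF z] Y2[OF z] mG1[OF subset_refl] mG2[OF subset_refl]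
  have "(\<integral>w. G1 J w \<partial>P1) = (\<integral>w. G1 J w * cos (Y1 w (\<lambda>t. 0)) \<partial>P1)"
    using lin1[OF z z, of 0 0] by (intro integral_cong_AE) auto
  also have "\<dots> = (\<integral>w. G2 J w * cos (Y2 w (\<lambda>t. 0)) \<partial>P2)"
    using main z by blast
  also have "\<dots> = (\<integral>w. G2 J w \<partial>P2)"
    using lin2[OF z z, of 0 0] by (intro integral_cong_AE) auto
  finally have eq: "(\<integral>w. G1 J w \<partial>P1) = (\<integral>w. G2 J w \<partial>P2)" .
  let ?S = "prod_emb (L2 T) (\<lambda>_. borel :: real measure) J (Pi\<^sub>E J A)"
  have S: "?S \<in> sets (PiM (L2 T) (\<lambda>_. borel))"
    using J A by (intro sets_PiM_I) auto
  have "(\<lambda>w. restrict (Y1 w) (L2 T)) -` ?S \<inter> space P1 = {w\<in>space P1. \<forall>j\<in>J. Y1 w j \<in> A j}"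
    "(\<lambda>w. restrict (Y2 w) (L2 T)) -` ?S \<inter> space P2 = {w\<in>space P2. \<forall>j\<in>J. Y2 w j \<in> A j}"
    using J(2) by (auto simp: prod_emb_iff PiE_iff subset_iff)
  note vim = this
  have "{w\<in>space P1. \<forall>j\<in>J. Y1 w j \<in> A j} \<in> sets P1" "{w\<in>space P2. \<forall>j\<in>J. Y2 w j \<in> A j} \<in> sets P2"
    unfolding vim[symmetric] by (intro measurable_sets[OF _ S]; simp)+
  note [measurable] = this
  have "(\<integral>w. G1 J w \<partial>P1) = (\<integral>w. indicator {w\<in>space P1. \<forall>j\<in>J. Y1 w j \<in> A j} w \<partial>P1)"
    using J(1) by (intro Bochner_Integration.integral_cong) (auto simp: G1_def indicator_def)
  moreover have "(\<integral>w. G2 J w \<partial>P2) = (\<integral>w. indicator {w\<in>space P2. \<forall>j\<in>J. Y2 w j \<in> A j} w \<partial>P2)"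
    using J(1) by (intro Bochner_Integration.integral_cong) (auto simp: G2_def indicator_def)
  ultimately have "measure P1 {w\<in>space P1. \<forall>j\<in>J. Y1 w j \<in> A j} = measure P2 {w\<in>space P2. \<forall>j\<in>J. Y2 w j \<in> A j}"
    using eq by simp
  then show "emeasure (distr P1 (PiM (L2 T) (\<lambda>_. borel)) (\<lambda>w. restrict (Y1 w) (L2 T))) ?S
      = emeasure (distr P2 (PiM (L2 T) (\<lambda>_. borel)) (\<lambda>w. restrict (Y2 w) (L2 T))) ?S"
    by (simp add: emeasure_distr S vim P1.emeasure_eq_measure P2.emeasure_eq_measure)
qed simp_all

section \<open>White noise and the Cameron--Martin theorem\<close>

locale white_noise_space = prob_space M
  for M :: "'w measure" +
  fixes T \<sigma> :: real and W :: "'w \<Rightarrow> (real \<Rightarrow> real) \<Rightarrow> real"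
  assumes noise: "white_noise M T \<sigma> W"
begin

lemma noise_pair_gaussian:
  assumes "f \<in> L2 T" "g \<in> L2 T"
  shows "gaussian_rv M (\<lambda>w. a * W w f + b * W w g) 0
    (\<sigma>\<^sup>2 * (a\<^sup>2 * L2inner T f f + 2 * a * b * L2inner T f g + b\<^sup>2 * L2inner T g g))"
  using noise assms by (simp add: white_noise_def)

lemma noise_gaussian:
  assumes "f \<in> L2 T"
  shows "gaussian_rv M (\<lambda>w. W w f) 0 (\<sigma>\<^sup>2 * L2inner T f f)"
  using noise_pair_gaussian[OF assms assms, of 1 0] by simp

lemma noise_measurable [measurable]: "f \<in> L2 T \<Longrightarrow> (\<lambda>w. W w f) \<in> borel_measurable M"
  using noise_gaussian by (simp add: gaussian_rv_def)

text \<open>The covariance alone forces linearity: the defect has second moment 0. The exceptional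
  null set may depend on \<open>f\<close>, \<open>g\<close>, \<open>a\<close> and
  \<open>b\<close>.\<close>

lemma noise_linear:
  assumes f: "f \<in> L2 T" and g: "g \<in> L2 T"
  shows "AE w in M. W w (\<lambda>t. a * f t + b * g t) = a * W w f + b * W w g"
proof -
  let ?u = "\<lambda>t. a * f t + b * g t"
  have u: "?u \<in> L2 T" using f g by (rule L2_lincomb)
  note [measurable] = noise_measurable[OF f] noise_measurable[OF g] noise_measurable[OF u]
  have sq: "integrable M (\<lambda>w. (c * W w p + d * W w q)\<^sup>2)"
    "(\<integral>w. (c * W w p + d * W w q)\<^sup>2 \<partial>M)
      = \<sigma>\<^sup>2 * (c\<^sup>2 * L2inner T p p + 2 * c * d * L2inner T p q + d\<^sup>2 * L2inner T q q)"
    if "p \<in> L2 T" "q \<in> L2 T" for c d p q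
    using gaussian_rv_second_moment[OF noise_pair_gaussian[OF that]] by auto
  let ?Z = "\<lambda>w. W w ?u - (a * W w f + b * W w g)"
  \<comment> \<open>The noise is only assumed pairwise Gaussian, so each square may involve at most two noise variables.\<close>
  have pol: "(?Z w)\<^sup>2 = (1 * W w ?u + (- a) * W w f)\<^sup>2 + (1 * W w ?u + (- b) * W w g)\<^sup>2
      + (a * W w f + b * W w g)\<^sup>2 - (1 * W w ?u + 0 * W w f)\<^sup>2
      - (a * W w f + 0 * W w g)\<^sup>2 - (0 * W w f + b * W w g)\<^sup>2" for w
    by (simp add: power2_eq_square algebra_simps)
  have int: "integrable M (\<lambda>w. (?Z w)\<^sup>2)"
    unfolding pol by (intro Bochner_Integration.integrable_add Bochner_Integration.integrable_diff sq f g u)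
  have "(\<integral>w. (?Z w)\<^sup>2 \<partial>M) = (\<integral>w. (1 * W w ?u + (- a) * W w f)\<^sup>2 \<partial>M) + (\<integral>w. (1 * W w ?u + (- b) * W w g)\<^sup>2 \<partial>M)
      + (\<integral>w. (a * W w f + b * W w g)\<^sup>2 \<partial>M) - (\<integral>w. (1 * W w ?u + 0 * W w f)\<^sup>2 \<partial>M)
      - (\<integral>w. (a * W w f + 0 * W w g)\<^sup>2 \<partial>M) - (\<integral>w. (0 * W w f + b * W w g)\<^sup>2 \<partial>M)"
    unfolding pol
    by (simp only: Bochner_Integration.integral_add Bochner_Integration.integral_diff
        Bochner_Integration.integrable_add Bochner_Integration.integrable_diff sq f g u)
  also have "\<dots> = 0"
    using f g u by (simp only: sq L2inner_lincomb_left L2inner_lincomb_right)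
      (simp add: L2inner_commute[of T g f] power2_eq_square algebra_simps)
  finally have "AE w in M. (?Z w)\<^sup>2 = 0"
    using integral_nonneg_eq_0_iff_AE[OF int] by simp
  then show ?thesis by eventually_elim simp
qed

lemma noise_trig:
  assumes "f \<in> L2 T"
  shows "(\<integral>w. cos (c + W w f) \<partial>M) = exp (- \<sigma>\<^sup>2 * L2inner T f f / 2) * cos c"
    and "(\<integral>w. sin (c + W w f) \<partial>M) = exp (- \<sigma>\<^sup>2 * L2inner T f f / 2) * sin c"
proof -
  note [measurable] = noise_measurable[OF assms]
  note * = gaussian_rv_exp_trig(2,3)[OF noise_gaussian[OF assms], of 0 1]
  have "integrable M (\<lambda>w. cos (W w f))" "integrable M (\<lambda>w. sin (W w f))" by auto
  then show "(\<integral>w. cos (c + W w f) \<partial>M) = exp (- \<sigma>\<^sup>2 * L2inner T f f / 2) * cos c"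
    "(\<integral>w. sin (c + W w f) \<partial>M) = exp (- \<sigma>\<^sup>2 * L2inner T f f / 2) * sin c"
    using * by (simp_all add: cos_add sin_add)
qed

text \<open>For orthogonal test functions the cross term of the joint Gaussian transform vanishes,
  so it factorises. The function \<open>F\<close> may be unbounded, because it is later built from
  an exponential.\<close>

lemma noise_orthogonal_integral:
  assumes f: "f \<in> L2 T" and g: "g \<in> L2 T" and orth: "L2inner T f g = 0"
    and F [measurable]: "F \<in> borel_measurable borel" and int: "integrable M (\<lambda>w. F (W w f))"
  shows "(\<integral>w. F (W w f) * cos (W w g) \<partial>M) = (\<integral>w. F (W w f) \<partial>M) * exp (- \<sigma>\<^sup>2 * L2inner T g g / 2)"
    and "(\<integral>w. F (W w f) * sin (W w g) \<partial>M) = 0"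
proof -
  have pair: "(\<integral>w. cos (t * W w f + s * W w g) \<partial>M)
      = exp (- \<sigma>\<^sup>2 * (t\<^sup>2 * L2inner T f f + s\<^sup>2 * L2inner T g g) / 2)"
    "(\<integral>w. sin (t * W w f + s * W w g) \<partial>M) = 0" for t s
    using gaussian_rv_exp_trig(2,3)[OF noise_pair_gaussian[OF f g, of t s], of 0 1] orth by simp_all
  have c: "(\<integral>w. cos (t * W w f) \<partial>M) = exp (- \<sigma>\<^sup>2 * (t\<^sup>2 * L2inner T f f) / 2)"
    "(\<integral>w. sin (t * W w f) \<partial>M) = 0" for t
    using pair[of t 0] by simp_all
  have cg: "(\<integral>w. cos (W w g) \<partial>M) = exp (- \<sigma>\<^sup>2 * L2inner T g g / 2)"
    using pair(1)[of 0 1] by simp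
  have "(\<integral>w. cos (t * W w f + W w g) \<partial>M) = (\<integral>w. cos (t * W w f) \<partial>M) * (\<integral>w. cos (W w g) \<partial>M)"
    "(\<integral>w. sin (t * W w f + W w g) \<partial>M) = 0" for t
    using pair[of t 1] by (simp_all add: c cg exp_add[symmetric] algebra_simps diff_divide_distrib)
  note * = integral_mult_trig_indep[OF noise_measurable[OF f] noise_measurable[OF g] _ c(2) this F int]
  show "(\<integral>w. F (W w f) * cos (W w g) \<partial>M) = (\<integral>w. F (W w f) \<partial>M) * exp (- \<sigma>\<^sup>2 * L2inner T g g / 2)"
    using *(1) by (simp add: cg)
  show "(\<integral>w. F (W w f) * sin (W w g) \<partial>M) = 0"
    using *(2) by simp
qed

section \<open>The likelihood ratio of two signals\<close>

definition likelihood :: "(real \<Rightarrow> real) \<Rightarrow> 'w \<Rightarrow> real" where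
  "likelihood d w = exp (W w d / \<sigma>\<^sup>2 - L2inner T d d / (2 * \<sigma>\<^sup>2))"

lemma likelihood_nonneg: "0 \<le> likelihood d w"
  by (simp add: likelihood_def)

lemma likelihood_measurable [measurable]: "d \<in> L2 T \<Longrightarrow> likelihood d \<in> borel_measurable M"
  unfolding likelihood_def by measurable

text \<open>Exponential moments of the Gaussian \<open>W d\<close> at
  \<open>1 / \<sigma>\<^sup>2\<close> and \<open>2 / \<sigma>\<^sup>2\<close>; the subtracted term
  in the exponent of \<open>likelihood\<close> normalises the mean to 1.\<close>

lemma likelihood_moments:
  assumes \<sigma>: "\<sigma> \<noteq> 0" and d: "d \<in> L2 T"
  shows "integrable M (likelihood d)" "(\<integral>w. likelihood d w \<partial>M) = 1"
    and "integrable M (\<lambda>w. (likelihood d w)\<^sup>2)"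
    and "(\<integral>w. (likelihood d w)\<^sup>2 \<partial>M) = exp (L2inner T d d / \<sigma>\<^sup>2)"
proof -
  have *: "integrable M (\<lambda>w. exp (s * W w d))"
    "(\<integral>w. exp (s * W w d) \<partial>M) = exp (s\<^sup>2 * (\<sigma>\<^sup>2 * L2inner T d d) / 2)" for s
    using gaussian_rv_exp_trig(1)[OF noise_gaussian[OF d], of s]
      gaussian_rv_exp_trig(2)[OF noise_gaussian[OF d], of s 0] by auto
  have e: "likelihood d w = exp (- L2inner T d d / (2 * \<sigma>\<^sup>2)) * exp (1 / \<sigma>\<^sup>2 * W w d)"
    "(likelihood d w)\<^sup>2 = exp (- L2inner T d d / \<sigma>\<^sup>2) * exp (2 / \<sigma>\<^sup>2 * W w d)" for w
    using \<sigma> by (simp_all add: likelihood_def exp_add[symmetric] exp_double[symmetric] field_simps)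
  have "integrable M (\<lambda>w. exp (- L2inner T d d / (2 * \<sigma>\<^sup>2)) * exp (1 / \<sigma>\<^sup>2 * W w d))"
    "integrable M (\<lambda>w. exp (- L2inner T d d / \<sigma>\<^sup>2) * exp (2 / \<sigma>\<^sup>2 * W w d))"
    by (intro integrable_mult_right *)+
  then show "integrable M (likelihood d)" "integrable M (\<lambda>w. (likelihood d w)\<^sup>2)"
    by (simp_all only: e[symmetric])
  show "(\<integral>w. likelihood d w \<partial>M) = 1"
    using \<sigma> by (simp only: e(1) integral_mult_right_zero *)
      (simp add: exp_add[symmetric] field_simps power2_eq_square)
  show "(\<integral>w. (likelihood d w)\<^sup>2 \<partial>M) = exp (L2inner T d d / \<sigma>\<^sup>2)"
    using \<sigma> by (simp only: e(2) integral_mult_right_zero *)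
      (simp add: exp_add[symmetric] field_simps power2_eq_square)
qed

text \<open>Under the tilted measure \<open>W f\<close> is still Gaussian with its old variance, but
  its mean becomes \<open>\<langle>f, d\<rangle>\<close>. To see this, split
  \<open>f = g + k d\<close> with \<open>g\<close> orthogonal to \<open>d\<close>: the tilt involves
  only \<open>W d\<close>, and the part from \<open>W g\<close> factors out.\<close>

lemma likelihood_trig:
  assumes \<sigma>: "\<sigma> \<noteq> 0" and d: "d \<in> L2 T" and f: "f \<in> L2 T"
  shows "(\<integral>w. likelihood d w * cos (c + W w f) \<partial>M)
      = exp (- \<sigma>\<^sup>2 * L2inner T f f / 2) * cos (c + L2inner T f d)"
    and "(\<integral>w. likelihood d w * sin (c + W w f) \<partial>M)
      = exp (- \<sigma>\<^sup>2 * L2inner T f f / 2) * sin (c + L2inner T f d)"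
proof -
  \<comment> \<open>If \<open>d\<close> is a null vector then \<open>k = 0\<close> by the convention \<open>x / 0 = 0\<close>, and \<open>f\<close> is already orthogonal to it.\<close>
  define k where "k = L2inner T f d / L2inner T d d"
  define g where "g = (\<lambda>t. 1 * f t + (- k) * d t)"
  have g: "g \<in> L2 T" unfolding g_def using f d by (rule L2_lincomb)
  note [measurable] = noise_measurable[OF f] noise_measurable[OF g] noise_measurable[OF d] likelihood_measurable[OF d]
  have kd: "k * L2inner T d d = L2inner T f d"
    using L2inner_Cauchy_Schwarz[OF f d] by (cases "L2inner T d d = 0") (auto simp: k_def)
  have orth: "L2inner T d g = 0"
    using f d kd unfolding g_def
    by (subst L2inner_lincomb_right) (auto simp: L2inner_commute[of T d f])
  have fg: "f = (\<lambda>t. 1 * g t + k * d t)" by (auto simp: g_def)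
  have norm_f: "L2inner T f f = L2inner T g g + k\<^sup>2 * L2inner T d d"
    using g d orth by (subst (1 2) fg, simp only: L2inner_lincomb_left L2inner_lincomb_right L2_lincomb)
      (simp add: L2inner_commute[of T g d] power2_eq_square)
  have Wf: "AE w in M. W w f = W w g + k * W w d"
    using noise_linear[OF g d, of 1 k] by (subst fg) simp
  define C where "C = exp (- L2inner T d d / (2 * \<sigma>\<^sup>2))"
  have lik: "likelihood d w = C * exp (1 / \<sigma>\<^sup>2 * W w d)" for w
    by (simp add: likelihood_def C_def exp_add[symmetric])
  let ?E = "\<lambda>x. exp (1 / \<sigma>\<^sup>2 * x)"
  have intE: "integrable M (\<lambda>w. ?E (W w d))"
    by (rule gaussian_rv_exp_trig(1)[OF noise_gaussian[OF d]])
  \<comment> \<open>The one-dimensional formula with \<open>s = 1 / \<sigma>\<^sup>2\<close> and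
    \<open>t = k\<close>. Its phase \<open>s t v\<close> is \<open>\<langle>f, d\<rangle>\<close>,
    and \<open>C\<close> cancels the part of the exponent that comes from \<open>s\<close>.\<close>
  have val: "C * (\<integral>w. ?E (W w d) * cos (k * W w d) \<partial>M) = exp (- k\<^sup>2 * \<sigma>\<^sup>2 * L2inner T d d / 2) * cos (L2inner T f d)"
    "C * (\<integral>w. ?E (W w d) * sin (k * W w d) \<partial>M) = exp (- k\<^sup>2 * \<sigma>\<^sup>2 * L2inner T d d / 2) * sin (L2inner T f d)"
  proof -
    have "1 / \<sigma>\<^sup>2 * k * (\<sigma>\<^sup>2 * L2inner T d d) = L2inner T f d"
      using \<sigma> kd by simp
    moreover have "C * exp (((1 / \<sigma>\<^sup>2)\<^sup>2 - k\<^sup>2) * (\<sigma>\<^sup>2 * L2inner T d d) / 2) = exp (- k\<^sup>2 * \<sigma>\<^sup>2 * L2inner T d d / 2)"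
      using \<sigma> by (simp add: C_def exp_add[symmetric] field_simps power2_eq_square)
    ultimately show
      "C * (\<integral>w. ?E (W w d) * cos (k * W w d) \<partial>M) = exp (- k\<^sup>2 * \<sigma>\<^sup>2 * L2inner T d d / 2) * cos (L2inner T f d)"
      "C * (\<integral>w. ?E (W w d) * sin (k * W w d) \<partial>M) = exp (- k\<^sup>2 * \<sigma>\<^sup>2 * L2inner T d d / 2) * sin (L2inner T f d)"
      by (simp_all only: gaussian_rv_exp_trig(2,3)[OF noise_gaussian[OF d]] mult.assoc[symmetric])
  qed
  \<comment> \<open>Here \<open>g\<close> and \<open>f\<close> are local names that shadow the
    component and the test function above. The trigonometric factors are bounded by 1, so the
    exponential dominates.\<close>
  have bounded: "integrable M (\<lambda>w. ?E (W w d) * g (W w d) * h (W w f))"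
    if [measurable]: "g \<in> borel_measurable borel" "h \<in> borel_measurable borel" "f \<in> L2 T"
      and "\<And>x. \<bar>g x\<bar> \<le> 1" "\<And>x. \<bar>h x\<bar> \<le> 1" for g h :: "real \<Rightarrow> real" and f
  proof (rule Bochner_Integration.integrable_bound[OF intE])
    show "AE w in M. norm (?E (W w d) * g (W w d) * h (W w f)) \<le> norm (?E (W w d))"
      using that by (auto simp: abs_mult mult.assoc intro!: mult_left_le mult_le_one)
  qed simp
  have split: "(\<integral>w. ?E (W w d) * g' (k * W w d) * cos (W w g) \<partial>M)
        = (\<integral>w. ?E (W w d) * g' (k * W w d) \<partial>M) * exp (- \<sigma>\<^sup>2 * L2inner T g g / 2)"
      "(\<integral>w. ?E (W w d) * g' (k * W w d) * sin (W w g) \<partial>M) = 0"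
      "integrable M (\<lambda>w. ?E (W w d) * g' (k * W w d) * cos (W w g))"
      "integrable M (\<lambda>w. ?E (W w d) * g' (k * W w d) * sin (W w g))"
    if [measurable]: "g' \<in> borel_measurable borel" and b: "\<And>x. \<bar>g' x\<bar> \<le> 1" for g' :: "real \<Rightarrow> real"
  proof -
    have "integrable M (\<lambda>w. ?E (W w d) * g' (k * W w d))"
      using bounded[of "\<lambda>x. g' (k * x)" "\<lambda>_. 1" d] b d by simp
    note noise_orthogonal_integral[OF d g orth _ this]
    then show "(\<integral>w. ?E (W w d) * g' (k * W w d) * cos (W w g) \<partial>M)
        = (\<integral>w. ?E (W w d) * g' (k * W w d) \<partial>M) * exp (- \<sigma>\<^sup>2 * L2inner T g g / 2)"
      "(\<integral>w. ?E (W w d) * g' (k * W w d) * sin (W w g) \<partial>M) = 0" by simp_all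
    show "integrable M (\<lambda>w. ?E (W w d) * g' (k * W w d) * cos (W w g))"
      "integrable M (\<lambda>w. ?E (W w d) * g' (k * W w d) * sin (W w g))"
      using bounded[of "\<lambda>x. g' (k * x)" cos g] bounded[of "\<lambda>x. g' (k * x)" sin g] b g by simp_all
  qed
  note sc = split[of cos, simplified] and ss = split[of sin, simplified]
  have fac: "exp (- \<sigma>\<^sup>2 * L2inner T f f / 2)
      = exp (- k\<^sup>2 * \<sigma>\<^sup>2 * L2inner T d d / 2) * exp (- \<sigma>\<^sup>2 * L2inner T g g / 2)"
    by (simp add: norm_f exp_add[symmetric] field_simps)
  let ?I = "\<lambda>u v. \<integral>w. ?E (W w d) * u (k * W w d) * v (W w g) \<partial>M"
  have cosf: "(\<integral>w. likelihood d w * cos (W w f) \<partial>M) = exp (- \<sigma>\<^sup>2 * L2inner T f f / 2) * cos (L2inner T f d)"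
  proof -
    have "(\<integral>w. likelihood d w * cos (W w f) \<partial>M) = (\<integral>w. C * (?E (W w d) * cos (k * W w d) * cos (W w g)
        - ?E (W w d) * sin (k * W w d) * sin (W w g)) \<partial>M)"
      using Wf by (intro integral_cong_AE) (auto simp: lik cos_add algebra_simps)
    also have "\<dots> = C * (?I cos cos - ?I sin sin)"
      using sc ss by simp
    also have "\<dots> = (C * (\<integral>w. ?E (W w d) * cos (k * W w d) \<partial>M)) * exp (- \<sigma>\<^sup>2 * L2inner T g g / 2)"
      using sc ss by simp
    finally show ?thesis unfolding val fac by simp
  qed
  have sinf: "(\<integral>w. likelihood d w * sin (W w f) \<partial>M) = exp (- \<sigma>\<^sup>2 * L2inner T f f / 2) * sin (L2inner T f d)"
  proof -
    have "(\<integral>w. likelihood d w * sin (W w f) \<partial>M) = (\<integral>w. C * (?E (W w d) * cos (k * W w d) * sin (W w g)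
        + ?E (W w d) * sin (k * W w d) * cos (W w g)) \<partial>M)"
      using Wf by (intro integral_cong_AE) (auto simp: lik sin_add algebra_simps)
    also have "\<dots> = C * (?I cos sin + ?I sin cos)"
      using sc ss by simp
    also have "\<dots> = (C * (\<integral>w. ?E (W w d) * sin (k * W w d) \<partial>M)) * exp (- \<sigma>\<^sup>2 * L2inner T g g / 2)"
      using sc ss by simp
    finally show ?thesis unfolding val fac by simp
  qed
  have int: "integrable M (\<lambda>w. likelihood d w * cos (W w f))" "integrable M (\<lambda>w. likelihood d w * sin (W w f))"
    by (rule Bochner_Integration.integrable_bound[OF likelihood_moments(1)[OF \<sigma> d]];
        simp add: abs_mult likelihood_nonneg mult_left_le)+
  \<comment> \<open>The addition theorem restores the offset \<open>c\<close> from the case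
    \<open>c = 0\<close>.\<close>
  have "(\<integral>w. likelihood d w * cos (c + W w f) \<partial>M)
      = (\<integral>w. cos c * (likelihood d w * cos (W w f)) - sin c * (likelihood d w * sin (W w f)) \<partial>M)"
    by (simp add: cos_add algebra_simps)
  also have "\<dots> = cos c * (\<integral>w. likelihood d w * cos (W w f) \<partial>M) - sin c * (\<integral>w. likelihood d w * sin (W w f) \<partial>M)"
    using int by simp
  finally show "(\<integral>w. likelihood d w * cos (c + W w f) \<partial>M)
      = exp (- \<sigma>\<^sup>2 * L2inner T f f / 2) * cos (c + L2inner T f d)"
    unfolding cosf sinf by (simp add: cos_add algebra_simps)
  have "(\<integral>w. likelihood d w * sin (c + W w f) \<partial>M)
      = (\<integral>w. sin c * (likelihood d w * cos (W w f)) + cos c * (likelihood d w * sin (W w f)) \<partial>M)"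
    by (simp add: sin_add algebra_simps)
  also have "\<dots> = sin c * (\<integral>w. likelihood d w * cos (W w f) \<partial>M) + cos c * (\<integral>w. likelihood d w * sin (W w f) \<partial>M)"
    using int by simp
  finally show "(\<integral>w. likelihood d w * sin (c + W w f) \<partial>M)
      = exp (- \<sigma>\<^sup>2 * L2inner T f f / 2) * sin (c + L2inner T f d)"
    unfolding cosf sinf by (simp add: sin_add algebra_simps)
qed

lemma observation_measurable [measurable]: "observation T x W \<in> measurable M (obs_space T)"
  unfolding observation_def obs_space_def by (rule measurable_restrict) simp

text \<open>The tilt adds \<open>\<langle>f, d\<rangle>\<close> to the mean of each coordinate,
  which turns \<open>\<langle>f, x\<rangle>\<close> into \<open>\<langle>f, x'\<rangle>\<close>. All
  linear functionals then have matching transforms, and these determine the law on the product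
  sigma-algebra.\<close>

theorem cameron_martin:
  assumes \<sigma>: "\<sigma> \<noteq> 0" and x: "x \<in> L2 T" and x': "x' \<in> L2 T"
  defines "d \<equiv> \<lambda>t. x' t - x t"
  shows "distr M (obs_space T) (observation T x' W)
       = distr (density M (\<lambda>w. ennreal (likelihood d w))) (obs_space T) (observation T x W)"
proof -
  have d: "d \<in> L2 T" unfolding d_def using x' x by (rule L2_diff)
  note [measurable] = likelihood_measurable[OF d]
  let ?Q = "density M (\<lambda>w. ennreal (likelihood d w))"
  have fin: "finite_measure ?Q"
  proof
    show "emeasure ?Q (space ?Q) \<noteq> \<infinity>"
      using likelihood_moments(1)[OF \<sigma> d]
      by (simp add: emeasure_density nn_integral_eq_integral likelihood_nonneg cong: nn_integral_cong_simp)
  qed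
  have iQ: "(\<integral>w. u w \<partial>?Q) = (\<integral>w. likelihood d w * u w \<partial>M)" if "u \<in> borel_measurable M" for u :: "'w \<Rightarrow> real"
    using that by (simp add: integral_density likelihood_nonneg)
  have inner_d: "L2inner T f x + L2inner T f d = L2inner T f x'" if "f \<in> L2 T" for f
    using that x x' by (simp add: d_def L2inner_diff_right)
  show ?thesis
    unfolding observation_def obs_space_def
  proof (rule distr_eq_if_linear_functionals_eq[OF finite_measure_axioms fin])
    fix f g and a b :: real assume f: "f \<in> L2 T" and g: "g \<in> L2 T"
    show "AE w in M. L2inner T (\<lambda>t. a * f t + b * g t) x' + W w (\<lambda>t. a * f t + b * g t)
        = a * (L2inner T f x' + W w f) + b * (L2inner T g x' + W w g)"
      using noise_linear[OF f g, of a b] f g x' by (simp add: L2inner_lincomb_left algebra_simps)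
    have "AE w in M. L2inner T (\<lambda>t. a * f t + b * g t) x + W w (\<lambda>t. a * f t + b * g t)
        = a * (L2inner T f x + W w f) + b * (L2inner T g x + W w g)"
      using noise_linear[OF f g, of a b] f g x by (simp add: L2inner_lincomb_left algebra_simps)
    then show "AE w in ?Q. L2inner T (\<lambda>t. a * f t + b * g t) x + W w (\<lambda>t. a * f t + b * g t)
        = a * (L2inner T f x + W w f) + b * (L2inner T g x + W w g)"
      by (subst AE_density) auto
  next
    fix f assume f: "f \<in> L2 T"
    show "(\<integral>w. cos (L2inner T f x' + W w f) \<partial>M) = (\<integral>w. cos (L2inner T f x + W w f) \<partial>?Q)"
      "(\<integral>w. sin (L2inner T f x' + W w f) \<partial>M) = (\<integral>w. sin (L2inner T f x + W w f) \<partial>?Q)"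
      using f by (simp_all add: iQ noise_trig likelihood_trig[OF \<sigma> d f] inner_d)
  qed simp_all
qed

lemma integral_change_of_signal:
  assumes \<sigma>: "\<sigma> \<noteq> 0" and x: "x \<in> L2 T" and x': "x' \<in> L2 T"
    and F [measurable]: "F \<in> borel_measurable (obs_space T)"
  defines "d \<equiv> \<lambda>t. x' t - x t"
  shows "integrable M (\<lambda>w. F (observation T x' W w))
      \<longleftrightarrow> integrable M (\<lambda>w. likelihood d w * (F (observation T x W w) :: real))"
    and "(\<integral>w. F (observation T x' W w) \<partial>M) = (\<integral>w. likelihood d w * F (observation T x W w) \<partial>M)"
proof -
  have d: "d \<in> L2 T" unfolding d_def using x' x by (rule L2_diff)
  note [measurable] = likelihood_measurable[OF d]
  let ?Q = "density M (\<lambda>w. ennreal (likelihood d w))"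
  have o [measurable]: "observation T x W \<in> measurable ?Q (obs_space T)" by simp
  note cm = cameron_martin[OF \<sigma> x x', folded d_def]
  have "integrable M (\<lambda>w. F (observation T x' W w)) \<longleftrightarrow> integrable ?Q (\<lambda>w. F (observation T x W w))"
    using integrable_distr_eq[OF observation_measurable[of x'] F] integrable_distr_eq[OF o F] cm by simp
  then show "integrable M (\<lambda>w. F (observation T x' W w))
      \<longleftrightarrow> integrable M (\<lambda>w. likelihood d w * F (observation T x W w))"
    by (simp add: integrable_density likelihood_nonneg)
  have "(\<integral>w. F (observation T x' W w) \<partial>M) = (\<integral>w. F (observation T x W w) \<partial>?Q)"
    using integral_distr[OF observation_measurable[of x'] F] integral_distr[OF o F] cm by simp
  then show "(\<integral>w. F (observation T x' W w) \<partial>M) = (\<integral>w. likelihood d w * F (observation T x W w) \<partial>M)"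
    by (simp add: integral_density likelihood_nonneg)
qed

end

section \<open>The Hammersley--Chapman--Robbins bound\<close>

lemma (in white_noise_space) hammersley_chapman_robbins:
  assumes \<sigma>: "\<sigma> \<noteq> 0" and x: "x \<in> L2 T" and x': "x' \<in> L2 T"
    and F [measurable]: "F \<in> borel_measurable (obs_space T)"
    and int: "integrable M (\<lambda>w. F (observation T x W w))" "integrable M (\<lambda>w. F (observation T x' W w))"
    and sq: "integrable M (\<lambda>w. (F (observation T x W w))\<^sup>2)"
  defines "d \<equiv> \<lambda>t. x' t - x t" and "m \<equiv> \<integral>w. (F (observation T x W w) :: real) \<partial>M"
  shows "((\<integral>w. F (observation T x' W w) \<partial>M) - m)\<^sup>2
      \<le> (\<integral>w. (F (observation T x W w) - m)\<^sup>2 \<partial>M) * (exp (L2inner T d d / \<sigma>\<^sup>2) - 1)"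
proof -
  have d: "d \<in> L2 T" unfolding d_def using x' x by (rule L2_diff)
  note [measurable] = likelihood_measurable[OF d]
  note lik = likelihood_moments[OF \<sigma> d]
  let ?X = "\<lambda>w. F (observation T x W w)"
  \<comment> \<open>Integrability of \<open>F\<close> under the signal \<open>x'\<close>, carried
    over by the change of signal.\<close>
  have LX: "integrable M (\<lambda>w. likelihood d w * ?X w)"
    using integral_change_of_signal(1)[OF \<sigma> x x' F] int(2) by (simp add: d_def)
  \<comment> \<open>The covariance of the statistic with the likelihood ratio is the difference of
    its means under the two signals.\<close>
  have "(\<integral>w. (?X w - m) * (likelihood d w - 1) \<partial>M)
      = (\<integral>w. likelihood d w * ?X w - ?X w - m * likelihood d w + m \<partial>M)"
    by (simp add: algebra_simps)
  also have "\<dots> = (\<integral>w. likelihood d w * ?X w \<partial>M) - m"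
    using LX int(1) lik by (simp add: prob_space m_def)
  also have "(\<integral>w. likelihood d w * ?X w \<partial>M) = (\<integral>w. F (observation T x' W w) \<partial>M)"
    using integral_change_of_signal(2)[OF \<sigma> x x' F] by (simp add: d_def)
  finally have cov: "(\<integral>w. (?X w - m) * (likelihood d w - 1) \<partial>M) = (\<integral>w. F (observation T x' W w) \<partial>M) - m" .
  have X2: "integrable M (\<lambda>w. (?X w - m)\<^sup>2)"
    using sq int(1) by (simp add: power2_diff)
  have L2': "integrable M (\<lambda>w. (likelihood d w - 1)\<^sup>2)"
    using lik by (simp add: power2_diff)
  have "(\<integral>w. (likelihood d w - 1)\<^sup>2 \<partial>M) = exp (L2inner T d d / \<sigma>\<^sup>2) - 1"
    using lik by (simp add: power2_diff prob_space)
  then show ?thesis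
    using integral_Cauchy_Schwarz[OF _ _ X2 L2'] cov by simp
qed

section \<open>Orthonormal directions in the parameter space and the bound along each\<close>

text \<open>Gram--Schmidt for an arbitrary inner product on the parameter space. With
  \<open>B\<close> the inner product pulled back along the derivative, the images of the vectors
  \<open>c i\<close> are orthonormal functions.\<close>

lemma exists_orthonormal_family:
  fixes B :: "'a::euclidean_space \<Rightarrow> 'a \<Rightarrow> real"
  assumes bil: "bilinear B" and sym: "\<And>u v. B u v = B v u" and pos: "\<And>u. u \<noteq> 0 \<Longrightarrow> B u u > 0"
    and "n \<le> DIM('a)"
  shows "\<exists>c :: nat \<Rightarrow> 'a. \<forall>i<n. \<forall>j<n. B (c i) (c j) = (if i = j then 1 else 0)"
  using \<open>n \<le> DIM('a)\<close>
proof (induction n)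
  case (Suc n)
  then obtain c :: "nat \<Rightarrow> 'a" where c: "\<And>i j. i < n \<Longrightarrow> j < n \<Longrightarrow> B (c i) (c j) = (if i = j then 1 else 0)"
    by auto
  \<comment> \<open>Fewer vectors than the dimension cannot span, which leaves a vector to
    orthogonalise.\<close>
  have "dim (c ` {..<n}) \<le> card (c ` {..<n})" by (rule dim_le_card') simp
  also have "\<dots> \<le> n" using card_image_le[of "{..<n}" c] by simp
  finally have "span (c ` {..<n}) \<noteq> UNIV"
    using Suc.prems by (metis dim_UNIV dim_span not_less_eq_eq)
  then obtain v where v: "v \<notin> span (c ` {..<n})" by auto
  define u where "u = v - (\<Sum>i<n. B v (c i) *\<^sub>R c i)"
  have "(\<Sum>i<n. B v (c i) *\<^sub>R c i) \<in> span (c ` {..<n})"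
    by (intro span_sum span_scale span_base) auto
  then have "u \<noteq> 0" using v by (auto simp: u_def)
  then have pu: "B u u > 0" by (rule pos)
  have lin: "linear (\<lambda>x. B x y)" for y using bil by (simp add: bilinear_def)
  have uc: "B u (c j) = 0" if j: "j < n" for j
  proof -
    have "B u (c j) = B v (c j) - (\<Sum>i<n. B v (c i) * B (c i) (c j))"
      by (simp add: u_def linear_diff[OF lin] linear_sum[OF lin] linear_scale[OF lin])
    also have "(\<Sum>i<n. B v (c i) * B (c i) (c j)) = (\<Sum>i<n. if i = j then B v (c i) else 0)"
      using j by (intro sum.cong) (auto simp: c)
    finally show ?thesis using j by simp
  qed
  define u' where "u' = (1 / sqrt (B u u)) *\<^sub>R u"
  have "B u' u' = 1"
    using pu by (simp add: u'_def bilinear_lmul[OF bil] bilinear_rmul[OF bil])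
  moreover have "B u' (c j) = 0" "B (c j) u' = 0" if "j < n" for j
    using uc[OF that] sym[of "c j" u'] by (simp_all add: u'_def bilinear_lmul[OF bil])
  ultimately have "\<forall>i<Suc n. \<forall>j<Suc n. B ((c(n := u')) i) ((c(n := u')) j) = (if i = j then 1 else 0)"
    using c by (auto simp: less_Suc_eq)
  then show ?case by blast
qed simp

text \<open>Between \<open>\<theta>\<close> and \<open>\<theta> + \<epsilon> *\<^sub>R c\<close> the
  mean changes by \<open>\<epsilon> (1 + q \<epsilon>)\<close> and the signal by squared norm
  \<open>\<epsilon>\<^sup>2 N \<epsilon>\<close>, with \<open>q\<close> tending to 0 and
  \<open>N\<close> to 1. Dividing the Hammersley--Chapman--Robbins bound by
  \<open>\<epsilon>\<^sup>2\<close> leaves \<open>1 \<le> V / \<sigma>\<^sup>2\<close> in the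
  limit.\<close>

lemma (in white_noise_space) directional_bound:
  fixes h :: "real^'k \<Rightarrow> real \<Rightarrow> real" and g :: "'k \<Rightarrow> real \<Rightarrow> real" and c :: "real^'k"
  assumes \<sigma>: "\<sigma> \<noteq> 0" and open_\<Theta>: "open \<Theta>" and \<theta>: "\<theta> \<in> \<Theta>"
    and h: "\<And>\<theta>. \<theta> \<in> \<Theta> \<Longrightarrow> h \<theta> \<in> L2 T" and g: "\<And>i. g i \<in> L2 T"
    and deriv: "((\<lambda>\<delta>. L2norm T (\<lambda>t. h (\<theta> + \<delta>) t - h \<theta> t - (\<Sum>i\<in>UNIV. \<delta> $ i * g i t)) / norm \<delta>)
            \<longlongrightarrow> 0) (at 0)"
    and e_def: "e = (\<lambda>t. \<Sum>i\<in>UNIV. c $ i * g i t)" and unit: "L2inner T e e = 1"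
    and F: "F \<in> borel_measurable (obs_space T)"
    and int: "\<And>\<theta>. \<theta> \<in> \<Theta> \<Longrightarrow> integrable M (\<lambda>w. F (observation T (h \<theta>) W w))"
    and mean: "\<And>\<theta>. \<theta> \<in> \<Theta> \<Longrightarrow> (\<integral>w. F (observation T (h \<theta>) W w) \<partial>M) = L2inner T (h \<theta>) e"
    and sq: "integrable M (\<lambda>w. (F (observation T (h \<theta>) W w))\<^sup>2)"
  shows "\<sigma>\<^sup>2 \<le> (\<integral>w. (F (observation T (h \<theta>) W w) - L2inner T (h \<theta>) e)\<^sup>2 \<partial>M)"
proof -
  define V where "V = (\<integral>w. (F (observation T (h \<theta>) W w) - L2inner T (h \<theta>) e)\<^sup>2 \<partial>M)"
  have V: "V \<ge> 0" unfolding V_def by (intro Bochner_Integration.integral_nonneg) simp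
  have e: "e \<in> L2 T" unfolding e_def using g by (intro L2_sum) auto
  have "c \<noteq> 0"
    using unit by (auto simp: e_def L2inner_def)
  define d where "d \<epsilon> = (\<lambda>t. h (\<theta> + \<epsilon> *\<^sub>R c) t - h \<theta> t)" for \<epsilon> :: real
  \<comment> \<open>The remainder of the first-order expansion along \<open>c\<close>; its norm is
    o(\<epsilon>).\<close>
  define r where "r \<epsilon> = (\<lambda>t. d \<epsilon> t - \<epsilon> * e t)" for \<epsilon> :: real
  have lim_line: "filterlim (\<lambda>\<epsilon>::real. \<epsilon> *\<^sub>R c) (at 0) (at 0)"
    unfolding filterlim_at using \<open>c \<noteq> 0\<close>
    by (auto simp: eventually_at_filter intro!: tendsto_eq_intros)
  have r_eq: "r \<epsilon> = (\<lambda>t. h (\<theta> + \<epsilon> *\<^sub>R c) t - h \<theta> t - (\<Sum>i\<in>UNIV. (\<epsilon> *\<^sub>R c) $ i * g i t))" for \<epsilon>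
    by (simp add: r_def d_def e_def sum_distrib_left mult.assoc)
  have "((\<lambda>\<epsilon>. L2norm T (r \<epsilon>) / norm (\<epsilon> *\<^sub>R c)) \<longlongrightarrow> 0) (at 0)"
    using filterlim_compose[OF deriv lim_line] unfolding r_eq .
  from tendsto_mult_right[OF this, of "norm c"]
  have r0: "((\<lambda>\<epsilon>. L2norm T (r \<epsilon>) / \<bar>\<epsilon>\<bar>) \<longlongrightarrow> 0) (at 0)"
    using \<open>c \<noteq> 0\<close> by simp
  have ev: "\<forall>\<^sub>F \<epsilon> in at 0. \<theta> + \<epsilon> *\<^sub>R c \<in> \<Theta> \<and> \<epsilon> \<noteq> 0"
  proof (intro eventually_conj)
    have "((\<lambda>\<epsilon>. \<theta> + \<epsilon> *\<^sub>R c) \<longlongrightarrow> \<theta>) (at 0)"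
      by (auto intro!: tendsto_eq_intros)
    then show "\<forall>\<^sub>F \<epsilon> in at 0. \<theta> + \<epsilon> *\<^sub>R c \<in> \<Theta>"
      using open_\<Theta> \<theta> by (rule topological_tendstoD)
  qed (simp add: eventually_at_filter)
  have inL2: "d \<epsilon> \<in> L2 T" "r \<epsilon> \<in> L2 T" if "\<theta> + \<epsilon> *\<^sub>R c \<in> \<Theta>" for \<epsilon>
  proof -
    show "d \<epsilon> \<in> L2 T" unfolding d_def by (intro L2_diff h that \<theta>)
    then show "r \<epsilon> \<in> L2 T" using L2_lincomb[OF _ e, of "d \<epsilon>" 1 "- \<epsilon>"] by (simp add: r_def)
  qed
  define q where "q \<epsilon> = L2inner T (r \<epsilon>) e / \<epsilon>" for \<epsilon>
  define p where "p \<epsilon> = L2norm T (r \<epsilon>) / \<bar>\<epsilon>\<bar>" for \<epsilon>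
  \<comment> \<open>Since \<open>e\<close> is a unit vector, Cauchy--Schwarz bounds
    \<open>\<bar>q \<epsilon>\<bar>\<close> by \<open>p \<epsilon>\<close>.\<close>
  have q0: "(q \<longlongrightarrow> 0) (at 0)"
  proof (rule Lim_null_comparison[OF _ r0])
    show "\<forall>\<^sub>F \<epsilon> in at 0. norm (q \<epsilon>) \<le> L2norm T (r \<epsilon>) / \<bar>\<epsilon>\<bar>"
      using ev
    proof eventually_elim
      case (elim \<epsilon>)
      have "(L2inner T (r \<epsilon>) e)\<^sup>2 \<le> (L2norm T (r \<epsilon>))\<^sup>2"
        using L2inner_Cauchy_Schwarz[OF inL2(2) e] elim by (simp add: L2norm_square unit)
      then have "\<bar>L2inner T (r \<epsilon>) e\<bar> \<le> L2norm T (r \<epsilon>)"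
        using L2norm_nonneg[of T "r \<epsilon>"] by (metis abs_le_square_iff abs_of_nonneg)
      then show ?case by (simp add: q_def divide_right_mono)
    qed
  qed
  have p0: "(p \<longlongrightarrow> 0) (at 0)" using r0 by (simp add: p_def[abs_def])
  define N where "N \<epsilon> = 1 + 2 * q \<epsilon> + (p \<epsilon>)\<^sup>2" for \<epsilon>
  have N1: "(N \<longlongrightarrow> 1) (at 0)"
    unfolding N_def by (auto intro!: tendsto_eq_intros p0 q0)
  have "\<forall>\<^sub>F \<epsilon> in at 0. (1 + q \<epsilon>)\<^sup>2 \<le> V * (N \<epsilon> / \<sigma>\<^sup>2 * exp (\<epsilon>\<^sup>2 * N \<epsilon> / \<sigma>\<^sup>2))"
    using ev
  proof eventually_elim
    case (elim \<epsilon>)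
    then have \<epsilon>: "\<epsilon> \<noteq> 0" and in\<Theta>: "\<theta> + \<epsilon> *\<^sub>R c \<in> \<Theta>" by auto
    note r = inL2(2)[OF in\<Theta>]
    have d_eq: "d \<epsilon> = (\<lambda>t. 1 * r \<epsilon> t + \<epsilon> * e t)" by (simp add: r_def)
    have "L2inner T (d \<epsilon>) e = \<epsilon> * (1 + q \<epsilon>)"
      unfolding d_eq using r e \<epsilon> by (subst L2inner_lincomb_left) (auto simp: unit q_def field_simps)
    moreover have "L2inner T (d \<epsilon>) e = L2inner T (h (\<theta> + \<epsilon> *\<^sub>R c)) e - L2inner T (h \<theta>) e"
      unfolding d_def by (intro L2inner_diff_left h in\<Theta> \<theta> e)
    ultimately have de: "L2inner T (h (\<theta> + \<epsilon> *\<^sub>R c)) e - L2inner T (h \<theta>) e = \<epsilon> * (1 + q \<epsilon>)"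
      by simp
    have "L2inner T (d \<epsilon>) (d \<epsilon>) = L2inner T (r \<epsilon>) (r \<epsilon>) + 2 * \<epsilon> * L2inner T (r \<epsilon>) e + \<epsilon>\<^sup>2"
      unfolding d_eq using r e by (simp only: L2inner_lincomb_left L2inner_lincomb_right L2_lincomb)
        (simp add: L2inner_commute[of T e "r \<epsilon>"] unit power2_eq_square algebra_simps)
    also have "\<dots> = \<epsilon>\<^sup>2 * N \<epsilon>"
      using \<epsilon> by (simp add: N_def q_def p_def L2norm_square[symmetric] field_simps power2_eq_square)
    finally have dd: "L2inner T (d \<epsilon>) (d \<epsilon>) = \<epsilon>\<^sup>2 * N \<epsilon>" .
    define y where "y = \<epsilon>\<^sup>2 * N \<epsilon> / \<sigma>\<^sup>2"
    \<comment> \<open>From \<open>1 - y \<le> exp (- y)\<close>. The upper bound has the explicit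
      factor \<open>y\<close>, hence \<open>\<epsilon>\<^sup>2\<close>, which cancels against the
      left-hand side.\<close>
    have ey: "exp y - 1 \<le> y * exp y"
    proof -
      have "(1 + - y) * exp y \<le> exp (- y) * exp y"
        by (intro mult_right_mono exp_ge_add_one_self) simp
      then show ?thesis by (simp add: exp_minus field_simps)
    qed
    have "(\<epsilon> * (1 + q \<epsilon>))\<^sup>2 \<le> V * (exp y - 1)"
      using hammersley_chapman_robbins[OF \<sigma> h[OF \<theta>] h[OF in\<Theta>] F int[OF \<theta>] int[OF in\<Theta>] sq]
      unfolding mean[OF \<theta>] mean[OF in\<Theta>] de d_def[symmetric] dd V_def[symmetric] y_def .
    also have "\<dots> \<le> V * (y * exp y)"
      using ey V by (rule mult_left_mono)
    also have "\<dots> = \<epsilon>\<^sup>2 * (V * (N \<epsilon> / \<sigma>\<^sup>2 * exp y))"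
      by (simp add: y_def)
    finally have "\<epsilon>\<^sup>2 * (1 + q \<epsilon>)\<^sup>2 \<le> \<epsilon>\<^sup>2 * (V * (N \<epsilon> / \<sigma>\<^sup>2 * exp y))"
      by (simp only: power_mult_distrib)
    then show ?case
      unfolding y_def by (rule mult_left_le_imp_le) (use \<epsilon> in simp)
  qed
  moreover have "((\<lambda>\<epsilon>. (1 + q \<epsilon>)\<^sup>2) \<longlongrightarrow> 1) (at 0)"
    by (auto intro!: tendsto_eq_intros q0)
  moreover have "((\<lambda>\<epsilon>. V * (N \<epsilon> / \<sigma>\<^sup>2 * exp (\<epsilon>\<^sup>2 * N \<epsilon> / \<sigma>\<^sup>2))) \<longlongrightarrow> V * (1 / \<sigma>\<^sup>2 * exp (0\<^sup>2 * 1 / \<sigma>\<^sup>2))) (at 0)"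
    using \<sigma> by (intro tendsto_intros N1) auto
  ultimately have "1 \<le> V * (1 / \<sigma>\<^sup>2 * exp (0\<^sup>2 * 1 / \<sigma>\<^sup>2))"
    by (intro tendsto_le[of "at (0::real)"]) auto
  then show ?thesis using \<sigma> by (simp add: V_def field_simps)
qed

section \<open>The bound for the estimator\<close>

lemma estimator_functional_measurable:
  assumes est: "(\<lambda>(y, t). xhat y t) \<in> borel_measurable (obs_space T \<Otimes>\<^sub>M lborel)" and \<phi>: "\<phi> \<in> L2 T"
  shows "(\<lambda>y. L2inner T (xhat y) \<phi>) \<in> borel_measurable (obs_space T)"
proof -
  note [measurable] = est L2_measurable[OF \<phi>]
  \<comment> \<open>Joint measurability in observation and time makes the integral over time a
    measurable function of the observation.\<close>
  have "case_prod (\<lambda>y t. indicator {0..T} t *\<^sub>R (xhat y t * \<phi> t)) \<in> borel_measurable (obs_space T \<Otimes>\<^sub>M lborel)"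
    by (simp add: split_beta') measurable
  then show ?thesis
    unfolding L2inner_def set_lebesgue_integral_def by (rule lborel.borel_measurable_lebesgue_integral)
qed

theorem theorem2:
  fixes T0 \<sigma> :: real
    and \<Theta> :: "(real^'k) set"
    and h :: "real^'k \<Rightarrow> real \<Rightarrow> real"
    and M :: "'w measure"
    and W :: "'w \<Rightarrow> (real \<Rightarrow> real) \<Rightarrow> real"
    and xhat :: "((real \<Rightarrow> real) \<Rightarrow> real) \<Rightarrow> real \<Rightarrow> real"
    and \<theta> :: "real^'k"
  assumes T0: "T0 > 0"
    and open_\<Theta>: "open \<Theta>"
    and h_L2: "\<forall>\<theta>\<in>\<Theta>. h \<theta> \<in> L2 T0"
    and P6_P7: "\<forall>\<theta>\<in>\<Theta>. \<exists>g :: 'k \<Rightarrow> real \<Rightarrow> real.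
        (\<forall>i. g i \<in> L2 T0) \<and>
        ((\<lambda>\<delta>. L2norm T0 (\<lambda>t. h (\<theta> + \<delta>) t - h \<theta> t - (\<Sum>i\<in>UNIV. \<delta> $ i * g i t)) / norm \<delta>)
            \<longlongrightarrow> 0) (at 0) \<and>
        (\<forall>\<delta>. L2norm T0 (\<lambda>t. \<Sum>i\<in>UNIV. \<delta> $ i * g i t) = 0 \<longrightarrow> \<delta> = 0)"
    and prob: "prob_space M"
    and noise: "white_noise M T0 \<sigma> W"
    and est_meas: "(\<lambda>(y, t). xhat y t) \<in> borel_measurable (obs_space T0 \<Otimes>\<^sub>M lborel)"
    and est_L2: "\<forall>y\<in>space (obs_space T0). xhat y \<in> L2 T0"
    and unbiased: "\<forall>\<theta>'\<in>\<Theta>. \<forall>\<phi>\<in>L2 T0.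
        integrable M (\<lambda>w. L2inner T0 (xhat (observation T0 (h \<theta>') W w)) \<phi>) \<and>
        (\<integral>w. L2inner T0 (xhat (observation T0 (h \<theta>') W w)) \<phi> \<partial>M) = L2inner T0 (h \<theta>') \<phi>"
    and second_moment: "\<forall>\<theta>'\<in>\<Theta>.
        integrable M (\<lambda>w. (L2norm T0 (xhat (observation T0 (h \<theta>') W w)))^2)"
    and \<theta>_in: "\<theta> \<in> \<Theta>"
  shows "(\<integral>w. (LINT t:{0..T0}|lborel. (xhat (observation T0 (h \<theta>) W w) t - h \<theta> t)^2) \<partial>M)
           \<ge> real CARD('k) * \<sigma>^2"
proof -
  interpret white_noise_space M T0 \<sigma> W
    using prob noise by (simp add: white_noise_space_def white_noise_space_axioms_def)
  define x where "x = h \<theta>"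
  define X where "X w = xhat (observation T0 x W w)" for w
  have x: "x \<in> L2 T0" using h_L2 \<theta>_in by (simp add: x_def)
  have X: "X w \<in> L2 T0" if "w \<in> space M" for w
    using est_L2 measurable_space[OF observation_measurable that] by (simp add: X_def)
  have XX: "integrable M (\<lambda>w. L2inner T0 (X w) (X w))"
    using second_moment \<theta>_in by (simp add: X_def x_def L2norm_square)
  have X\<phi>: "integrable M (\<lambda>w. L2inner T0 (X w) \<phi>)" if "\<phi> \<in> L2 T0" for \<phi>
    using unbiased \<theta>_in that by (simp add: X_def x_def)
  have X\<phi>2: "integrable M (\<lambda>w. (L2inner T0 (X w) \<phi>)\<^sup>2)" if \<phi>: "\<phi> \<in> L2 T0" for \<phi>
  proof (rule Bochner_Integration.integrable_bound)
    show "integrable M (\<lambda>w. L2inner T0 (X w) (X w) * L2inner T0 \<phi> \<phi>)" using XX by simp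
    show "(\<lambda>w. (L2inner T0 (X w) \<phi>)\<^sup>2) \<in> borel_measurable M"
      using X\<phi>[OF \<phi>] by simp
    \<comment> \<open>By Cauchy--Schwarz, the second moment of the estimator controls that of each
      of its functionals.\<close>
    show "AE w in M. norm ((L2inner T0 (X w) \<phi>)\<^sup>2) \<le> norm (L2inner T0 (X w) (X w) * L2inner T0 \<phi> \<phi>)"
      using L2inner_Cauchy_Schwarz[OF X \<phi>] by (intro AE_I2) (simp add: L2inner_self_nonneg)
  qed
  let ?err = "\<lambda>w. L2inner T0 (\<lambda>t. X w t - x t) (\<lambda>t. X w t - x t)"
  have goal_eq: "(\<integral>w. (LINT t:{0..T0}|lborel. (xhat (observation T0 (h \<theta>) W w) t - h \<theta> t)^2) \<partial>M) = (\<integral>w. ?err w \<partial>M)"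
    by (simp add: X_def x_def L2inner_def power2_eq_square)
  have err_eq: "?err w = L2inner T0 (X w) (X w) - 2 * L2inner T0 (X w) x + L2inner T0 x x" if "w \<in> space M" for w
    using X[OF that] x L2_diff[OF X[OF that] x]
    by (simp add: L2inner_diff_left L2inner_diff_right L2inner_commute[of T0 x "X w"])
  have "integrable M (\<lambda>w. L2inner T0 (X w) (X w) - 2 * L2inner T0 (X w) x + L2inner T0 x x)"
    using XX X\<phi>[OF x] by simp
  then have err_int: "integrable M ?err"
    using err_eq by (simp cong: Bochner_Integration.integrable_cong)
  show ?thesis
  \<comment> \<open>The likelihood ratio divides by \<open>\<sigma>\<^sup>2\<close>; without noise
    the bound is just nonnegativity of the error.\<close>
  proof (cases "\<sigma> = 0")
    case True
    then show ?thesis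
      unfolding goal_eq by (auto intro!: Bochner_Integration.integral_nonneg L2inner_self_nonneg)
  next
    case \<sigma>: False
    obtain g :: "'k \<Rightarrow> real \<Rightarrow> real" where g: "\<And>i. g i \<in> L2 T0"
      and deriv: "((\<lambda>\<delta>. L2norm T0 (\<lambda>t. h (\<theta> + \<delta>) t - h \<theta> t - (\<Sum>i\<in>UNIV. \<delta> $ i * g i t)) / norm \<delta>)
            \<longlongrightarrow> 0) (at 0)"
      and inj: "\<And>\<delta>. L2norm T0 (\<lambda>t. \<Sum>i\<in>UNIV. \<delta> $ i * g i t) = 0 \<Longrightarrow> \<delta> = 0"
      using P6_P7 \<theta>_in by blast
    define D where "D \<delta> = (\<lambda>t. \<Sum>i\<in>UNIV. \<delta> $ i * g i t)" for \<delta> :: "real^'k"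
    have D: "D \<delta> \<in> L2 T0" for \<delta> unfolding D_def using g by (intro L2_sum) auto
    have D_add: "D (a + b) = (\<lambda>t. 1 * D a t + 1 * D b t)" for a b
      by (simp add: D_def sum.distrib algebra_simps)
    have D_scale: "D (s *\<^sub>R a) = (\<lambda>t. s * D a t)" for s a
      by (simp add: D_def sum_distrib_left mult.assoc)
    \<comment> \<open>The Gram form of the derivative, which is \<open>\<sigma>\<^sup>2\<close>
      times the Fisher information. Injectivity of the derivative makes it positive
      definite.\<close>
    define B where "B u v = L2inner T0 (D u) (D v)" for u v
    have "B (a + b) v = B a v + B b v" "B v (a + b) = B v a + B v b" for a b v
      unfolding B_def D_add L2inner_lincomb_left[OF D D D] L2inner_lincomb_right[OF D D D] by simp_all
    then have "bilinear B"
      unfolding bilinear_def by (auto intro!: linearI simp: B_def D_scale L2inner_scale_left L2inner_scale_right)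
    moreover have "B u u > 0" if "u \<noteq> 0" for u
    proof -
      have "L2inner T0 (D u) (D u) \<noteq> 0"
        using inj[of u] that by (auto simp: D_def[symmetric] L2norm_eq_0_iff)
      then show ?thesis
        using L2inner_self_nonneg[of T0 "D u"] by (simp add: B_def)
    qed
    ultimately obtain c :: "nat \<Rightarrow> real^'k" where
      c: "\<And>i j. i < CARD('k) \<Longrightarrow> j < CARD('k) \<Longrightarrow> B (c i) (c j) = (if i = j then 1 else 0)"
      using exists_orthonormal_family[of B "CARD('k)"] by (auto simp: B_def L2inner_commute)
    have low: "\<sigma>\<^sup>2 \<le> (\<integral>w. (L2inner T0 (X w) (D (c j)) - L2inner T0 x (D (c j)))\<^sup>2 \<partial>M)" if "j < CARD('k)" for j
      unfolding X_def x_def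
    proof (rule directional_bound[OF \<sigma> open_\<Theta> \<theta>_in _ g deriv D_def])
      show "L2inner T0 (D (c j)) (D (c j)) = 1"
        using c[OF that that] by (simp add: B_def)
      show "(\<lambda>y. L2inner T0 (xhat y) (D (c j))) \<in> borel_measurable (obs_space T0)"
        by (rule estimator_functional_measurable[OF est_meas D])
      show "integrable M (\<lambda>w. (L2inner T0 (xhat (observation T0 (h \<theta>) W w)) (D (c j)))\<^sup>2)"
        using X\<phi>2[OF D] by (simp add: X_def x_def)
    qed (use h_L2 unbiased D in auto)
    have "real CARD('k) * \<sigma>\<^sup>2 = (\<Sum>j<CARD('k). \<sigma>\<^sup>2)" by simp
    also have "\<dots> \<le> (\<Sum>j<CARD('k). \<integral>w. (L2inner T0 (X w) (D (c j)) - L2inner T0 x (D (c j)))\<^sup>2 \<partial>M)"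
      by (intro sum_mono low) simp
    also have "\<dots> = (\<integral>w. (\<Sum>j<CARD('k). (L2inner T0 (X w) (D (c j)) - L2inner T0 x (D (c j)))\<^sup>2) \<partial>M)"
      using X\<phi>[OF D] X\<phi>2[OF D] by (intro Bochner_Integration.integral_sum[symmetric]) (simp add: power2_diff)
    also have "\<dots> \<le> (\<integral>w. ?err w \<partial>M)"
    proof (rule integral_mono)
      show "integrable M (\<lambda>w. \<Sum>j<CARD('k). (L2inner T0 (X w) (D (c j)) - L2inner T0 x (D (c j)))\<^sup>2)"
        using X\<phi>[OF D] X\<phi>2[OF D] by (simp add: power2_diff)
      fix w assume w: "w \<in> space M"
      \<comment> \<open>Bessel's inequality for the error at each outcome, with the orthonormal
        functions \<open>D (c j)\<close>.\<close>
      have "(\<Sum>j<CARD('k). (L2inner T0 (\<lambda>t. X w t - x t) (D (c j)))\<^sup>2) \<le> ?err w"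
        using c by (intro L2inner_bessel D L2_diff X w x) (auto simp: B_def)
      then show "(\<Sum>j<CARD('k). (L2inner T0 (X w) (D (c j)) - L2inner T0 x (D (c j)))\<^sup>2) \<le> ?err w"
        using X[OF w] x D by (simp add: L2inner_diff_left)
    qed (rule err_int)
    finally show ?thesis unfolding goal_eq .
  qed
qed

end
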